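(* Let $\psi_{-1}=(\psi_{-1}^{(d)})_{d\ge1}\in\mathcal{O}$ be the element, homogeneous of weight $-1$, with components $$\psi_{-1}^{(d)}=\sum_{v\in\mathcal{V}_d}\frac{(-1)^{h(v)+1}}{h(v)}\,\frac{1}{x_v\,x_d},$$ where the sum is over all vines $v$ with $d$ grapes. Then $\psi_{-1}\in\mathfrak{p}\mathfrak{dmr}$, i.e. $\psi_{-1}$ satisfies the double shuffle equations modulo products.
   Context: For $d\ge1$ let $\mathcal{O}_d=\mathbb{Q}[x_1,\dots,x_d,x_1^{-1},\dots,x_d^{-1},((x_i-x_j)^{-1})_{1\le i<j\le d}]$ and $\mathcal{O}=\prod_{d\ge1}\mathcal{O}_d$; write $f=(f^{(d)})_{d\ge1}$. An element $f\in\mathcal{O}$ is homogeneous of weight $w$ if each $f^{(d)}$ is homogeneous of degree $w-d$. Vines: a vine $v\in\mathcal{V}_d$ is a word $v=g_{i_1}\cdots g_{i_k}$ with $i_1,\dots,i_k\ge1$ and $i_1+\dots+i_k=d$; $h(v)=k$ is its height. With $S_0=0$, $S_j=i_1+\dots+i_j$ and $x_0=0$, its associated polynomial is $$x_v=\prod_{j=1}^{k}\prod_{m=1}^{i_j}\bigl(x_{S_{j-1}+m}-x_{S_{j-1}}\bigr).$$ (It is the rooted tree on $\{0,\dots,d\}$ in which vertex $S_{j-1}$ is joined to $S_{j-1}+1,\dots,S_j$.) Shuffle equations modulo products: for all $p,q\ge1$, $$\sum_{w\in \mathrm{Sh}(p,q)} f^{(p+q)}(x_{w_1},\,x_{w_1}+x_{w_2},\,\dots,\,x_{w_1}+\dots+x_{w_{p+q}})=0,$$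 where $\mathrm{Sh}(p,q)$ is the set of rearrangements $w=(w_1,\dots,w_{p+q})$ of $(1,\dots,p+q)$ in which $1,\dots,p$ appear in increasing order and $p+1,\dots,p+q$ appear in increasing order. Stuffle equations modulo products: for sequences $u,v,w$ of distinct variables define $F(u;v*w)$ recursively by $F(u;\emptyset*w)=F(u;w*\emptyset)=f^{(|u|+|w|)}(u,w)$ and, for variables $a,b$, $$F(u;av*bw)=F(ua;v*bw)+F(ub;av*w)+\frac{F(ua;v*w)-F(ub;v*w)}{a-b}.$$ The equations are $F(\emptyset;x_1\cdots x_p*x_{p+1}\cdots x_{p+q})=0$ for all $p,q\ge1$. $\mathfrak{p}\mathfrak{dmr}\subset\mathcal{O}$ is the set of $f\in\mathcal{O}$ satisfying both the shuffle and the stuffle equations modulo products. *)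

theory Defs
  imports
    Complex_Main
    "HOL-Library.Poly_Mapping"
    "HOL-Computational_Algebra.Fraction_Field"
begin

section \<open>Rational functions in countably many variables\<close>

text \<open>Polynomials over the rationals are finitely supported functions from exponent vectors to
  coefficients, with the convolution product of \<^theory>\<open>HOL-Library.Poly_Mapping\<close>.  All the rings
  \<open>\<O>\<^sub>d\<close> live in the single field \<open>\<rat>(x\<^sub>1, x\<^sub>2, \<dots>)\<close>; the variable with index \<open>0\<close> is never used.\<close>

type_synonym ratpoly = "(nat \<Rightarrow>\<^sub>0 nat) \<Rightarrow>\<^sub>0 rat"
type_synonym ratfun = "ratpoly fract"

definition rf_const :: "rat \<Rightarrow> ratfun" where
  "rf_const c = Fract (Poly_Mapping.single 0 c) 1"

text \<open>The convention \<open>x\<^sub>0 = 0\<close> is built in.\<close>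

definition X :: "nat \<Rightarrow> ratfun" where
  "X i = (if i = 0 then 0
          else Fract (Poly_Mapping.single (Poly_Mapping.single i 1) 1) 1)"

definition poly_eval :: "(nat \<Rightarrow> ratfun) \<Rightarrow> ratpoly \<Rightarrow> ratfun" where
  "poly_eval \<sigma> p =
     (\<Sum>m\<in>Poly_Mapping.keys p. rf_const (Poly_Mapping.lookup p m) *
        (\<Prod>i\<in>Poly_Mapping.keys m. \<sigma> i ^ Poly_Mapping.lookup m i))"

text \<open>The value is meaningful whenever \<open>f\<close> has some representation whose denominator does not
  vanish under \<open>\<sigma>\<close>; it then does not depend on the representation, see \<open>rf_subst_Fract\<close> below.\<close>

definition rf_subst :: "(nat \<Rightarrow> ratfun) \<Rightarrow> ratfun \<Rightarrow> ratfun" where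
  "rf_subst \<sigma> f =
     (THE y. \<exists>p q. q \<noteq> 0 \<and> f = Fract p q \<and> poly_eval \<sigma> q \<noteq> 0 \<and>
                   y = poly_eval \<sigma> p / poly_eval \<sigma> q)"

text \<open>\<open>rf_app f [t\<^sub>1, \<dots>, t\<^sub>d]\<close> is \<open>f(t\<^sub>1, \<dots>, t\<^sub>d)\<close>, for \<open>f\<close> a rational function of \<open>x\<^sub>1, \<dots>, x\<^sub>d\<close>.\<close>

definition rf_app :: "ratfun \<Rightarrow> ratfun list \<Rightarrow> ratfun" where
  "rf_app f ts = rf_subst (\<lambda>i. if 1 \<le> i \<and> i \<le> length ts then ts ! (i - 1) else 0) f"

definition poly_homogeneous :: "nat \<Rightarrow> ratpoly \<Rightarrow> bool" where
  "poly_homogeneous n p \<longleftrightarrow>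
     (\<forall>m\<in>Poly_Mapping.keys p. (\<Sum>i\<in>Poly_Mapping.keys m. Poly_Mapping.lookup m i) = n)"

definition rf_homogeneous :: "int \<Rightarrow> ratfun \<Rightarrow> bool" where
  "rf_homogeneous n f \<longleftrightarrow>
     (\<exists>p q a b. q \<noteq> 0 \<and> f = Fract p q \<and> poly_homogeneous a p \<and> poly_homogeneous b q \<and>
                n = int a - int b)"


section \<open>The ring \<open>\<O>\<close>\<close>

inductive_set O_comp :: "nat \<Rightarrow> ratfun set" for d :: nat where
  const: "rf_const c \<in> O_comp d"
| var: "1 \<le> i \<Longrightarrow> i \<le> d \<Longrightarrow> X i \<in> O_comp d"
| inverse_var: "1 \<le> i \<Longrightarrow> i \<le> d \<Longrightarrow> inverse (X i) \<in> O_comp d"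
| inverse_diff: "1 \<le> i \<Longrightarrow> i < j \<Longrightarrow> j \<le> d \<Longrightarrow> inverse (X i - X j) \<in> O_comp d"
| add: "f \<in> O_comp d \<Longrightarrow> g \<in> O_comp d \<Longrightarrow> f + g \<in> O_comp d"
| mult: "f \<in> O_comp d \<Longrightarrow> g \<in> O_comp d \<Longrightarrow> f * g \<in> O_comp d"

text \<open>Elements of \<open>\<O>\<close> are sequences indexed by \<open>d \<ge> 1\<close>; the value at \<open>0\<close> is irrelevant.\<close>

definition O_ring :: "(nat \<Rightarrow> ratfun) set" where
  "O_ring = {f. \<forall>d\<ge>1. f d \<in> O_comp d}"

definition homogeneous_of_weight :: "int \<Rightarrow> (nat \<Rightarrow> ratfun) \<Rightarrow> bool" where
  "homogeneous_of_weight w f \<longleftrightarrow> (\<forall>d\<ge>1. rf_homogeneous (w - int d) (f d))"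


section \<open>Vines\<close>

text \<open>The vine \<open>g\<^sub>i\<^sub>1 \<cdots> g\<^sub>i\<^sub>k\<close> is represented by the list \<open>[i\<^sub>1, \<dots>, i\<^sub>k]\<close>; its height is the length.\<close>

definition vines :: "nat \<Rightarrow> nat list set" where
  "vines d = {v. (\<forall>i\<in>set v. 1 \<le> i) \<and> sum_list v = d}"

definition vine_S :: "nat list \<Rightarrow> nat \<Rightarrow> nat" where
  "vine_S v j = sum_list (take j v)"

text \<open>List positions start at \<open>0\<close>, so the \<open>j\<close>-th letter of the word is \<open>v ! (j - 1)\<close>.\<close>

definition vine_poly :: "nat list \<Rightarrow> ratfun" where
  "vine_poly v =
     (\<Prod>j=1..length v. \<Prod>m=1..v ! (j - 1). X (vine_S v (j - 1) + m) - X (vine_S v (j - 1)))"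

definition psi_m1 :: "nat \<Rightarrow> ratfun" where
  "psi_m1 d =
     (\<Sum>v\<in>vines d. (-1) ^ (length v + 1) / of_nat (length v) * (1 / (vine_poly v * X d)))"


section \<open>Double shuffle equations modulo products\<close>

definition Sh :: "nat \<Rightarrow> nat \<Rightarrow> nat list set" where
  "Sh p q = {w. distinct w \<and> set w = {1..p + q} \<and>
                sorted (filter (\<lambda>i. i \<le> p) w) \<and> sorted (filter (\<lambda>i. p < i) w)}"

definition shuffle_mod_products :: "(nat \<Rightarrow> ratfun) \<Rightarrow> bool" where
  "shuffle_mod_products f \<longleftrightarrow>
     (\<forall>p\<ge>1. \<forall>q\<ge>1.
        (\<Sum>w\<in>Sh p q. rf_app (f (p + q)) (map (\<lambda>k. \<Sum>i<k. X (w ! i)) [1..<p + q + 1])) = 0)"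

text \<open>\<open>stuffle_F f u v w\<close> is \<open>F(u; v * w)\<close>, the variables being given by their indices.\<close>

function stuffle_F ::
    "(nat \<Rightarrow> ratfun) \<Rightarrow> nat list \<Rightarrow> nat list \<Rightarrow> nat list \<Rightarrow> ratfun" where
  "stuffle_F f u [] w = rf_app (f (length u + length w)) (map X (u @ w))"
| "stuffle_F f u w [] = rf_app (f (length u + length w)) (map X (u @ w))"
| "stuffle_F f u (a # v) (b # w) =
     stuffle_F f (u @ [a]) v (b # w) + stuffle_F f (u @ [b]) (a # v) w +
     (stuffle_F f (u @ [a]) v w - stuffle_F f (u @ [b]) v w) / (X a - X b)"
  by (auto, metis neq_Nil_conv)
termination
  by (relation "measure (\<lambda>(f, u, v, w). length v + length w)") auto

definition stuffle_mod_products :: "(nat \<Rightarrow> ratfun) \<Rightarrow> bool" where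
  "stuffle_mod_products f \<longleftrightarrow>
     (\<forall>p\<ge>1. \<forall>q\<ge>1. stuffle_F f [] [1..<p + 1] [p + 1..<p + q + 1] = 0)"

definition pdmr :: "(nat \<Rightarrow> ratfun) set" where
  "pdmr = {f \<in> O_ring. shuffle_mod_products f \<and> stuffle_mod_products f}"


section \<open>Substitution is well defined\<close>

lemma rf_const_0 [simp]: "rf_const 0 = 0"
  by (simp add: rf_const_def Zero_fract_def)

lemma rf_const_1 [simp]: "rf_const 1 = 1"
  by (simp add: rf_const_def One_fract_def)

lemma rf_const_add: "rf_const (a + b) = rf_const a + rf_const b"
  by (simp add: rf_const_def single_add)

lemma rf_const_mult: "rf_const (a * b) = rf_const a * rf_const b"
  by (simp add: rf_const_def mult_single)

lemma poly_eval_superset: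
  assumes "finite A" "Poly_Mapping.keys p \<subseteq> A"
  shows "poly_eval \<sigma> p = (\<Sum>m\<in>A. rf_const (Poly_Mapping.lookup p m) *
        (\<Prod>i\<in>Poly_Mapping.keys m. \<sigma> i ^ Poly_Mapping.lookup m i))"
  unfolding poly_eval_def
  by (rule sum.mono_neutral_left) (use assms in \<open>auto simp: in_keys_iff\<close>)

lemma poly_eval_add: "poly_eval \<sigma> (p + q) = poly_eval \<sigma> p + poly_eval \<sigma> q"
proof -
  let ?A = "Poly_Mapping.keys p \<union> Poly_Mapping.keys q"
  have "Poly_Mapping.keys (p + q) \<subseteq> ?A" by (rule keys_add)
  then show ?thesis
    using poly_eval_superset[of ?A p] poly_eval_superset[of ?A q]
          poly_eval_superset[of ?A "p + q"]
    by (simp add: lookup_add rf_const_add distrib_right sum.distrib)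
qed

lemma poly_eval_0 [simp]: "poly_eval \<sigma> 0 = 0"
  by (simp add: poly_eval_def)

lemma poly_eval_sum: "poly_eval \<sigma> (\<Sum>a\<in>A. g a) = (\<Sum>a\<in>A. poly_eval \<sigma> (g a))"
  by (induction A rule: infinite_finite_induct) (simp_all add: poly_eval_add)

lemma poly_eval_single:
  "poly_eval \<sigma> (Poly_Mapping.single m c) =
     rf_const c * (\<Prod>i\<in>Poly_Mapping.keys m. \<sigma> i ^ Poly_Mapping.lookup m i)"
  by (cases "c = 0") (simp_all add: poly_eval_def)

lemma monom_eval_superset:
  fixes \<sigma> :: "nat \<Rightarrow> ratfun"
  assumes "finite A" "Poly_Mapping.keys m \<subseteq> A"
  shows "(\<Prod>i\<in>Poly_Mapping.keys m. \<sigma> i ^ Poly_Mapping.lookup m i) =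
         (\<Prod>i\<in>A. \<sigma> i ^ Poly_Mapping.lookup m i)"
  by (rule prod.mono_neutral_left) (use assms in \<open>auto simp: in_keys_iff\<close>)

lemma monom_eval_add:
  fixes \<sigma> :: "nat \<Rightarrow> ratfun"
  shows "(\<Prod>i\<in>Poly_Mapping.keys (m + n). \<sigma> i ^ Poly_Mapping.lookup (m + n) i) =
     (\<Prod>i\<in>Poly_Mapping.keys m. \<sigma> i ^ Poly_Mapping.lookup m i) *
     (\<Prod>i\<in>Poly_Mapping.keys n. \<sigma> i ^ Poly_Mapping.lookup n i)"
proof -
  let ?A = "Poly_Mapping.keys m \<union> Poly_Mapping.keys n"
  have "Poly_Mapping.keys (m + n) \<subseteq> ?A" by (rule keys_add)
  then show ?thesis
    using monom_eval_superset[of ?A m \<sigma>] monom_eval_superset[of ?A n \<sigma>]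
          monom_eval_superset[of ?A "m + n" \<sigma>]
    by (simp add: lookup_add power_add prod.distrib)
qed

lemma poly_eval_mult: "poly_eval \<sigma> (p * q) = poly_eval \<sigma> p * poly_eval \<sigma> q"
proof -
  let ?t = "\<lambda>r k. Poly_Mapping.single k (Poly_Mapping.lookup r k) :: ratpoly"
  have dec: "r = (\<Sum>k\<in>Poly_Mapping.keys r. ?t r k)" for r :: ratpoly
    by (rule poly_mapping_eqI)
       (auto simp: lookup_sum lookup_single when_def in_keys_iff sum.delta)
  have "p * q = (\<Sum>k\<in>Poly_Mapping.keys p. ?t p k) * (\<Sum>l\<in>Poly_Mapping.keys q. ?t q l)"
    using dec[of p] dec[of q] by simp
  then have "poly_eval \<sigma> (p * q) =
      (\<Sum>k\<in>Poly_Mapping.keys p. \<Sum>l\<in>Poly_Mapping.keys q. poly_eval \<sigma> (?t p k * ?t q l))"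
    by (simp only: sum_product poly_eval_sum)
  also have "\<dots> = (\<Sum>k\<in>Poly_Mapping.keys p. \<Sum>l\<in>Poly_Mapping.keys q.
         poly_eval \<sigma> (?t p k) * poly_eval \<sigma> (?t q l))"
    by (simp only: mult_single poly_eval_single rf_const_mult monom_eval_add mult_ac)
  also have "\<dots> = poly_eval \<sigma> (\<Sum>k\<in>Poly_Mapping.keys p. ?t p k) *
                  poly_eval \<sigma> (\<Sum>l\<in>Poly_Mapping.keys q. ?t q l)"
    by (simp only: sum_product poly_eval_sum)
  also have "\<dots> = poly_eval \<sigma> p * poly_eval \<sigma> q"
    using dec[of p] dec[of q] by simp
  finally show ?thesis .
qed

lemma rf_subst_Fract:
  assumes "q \<noteq> 0" "poly_eval \<sigma> q \<noteq> 0"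
  shows "rf_subst \<sigma> (Fract p q) = poly_eval \<sigma> p / poly_eval \<sigma> q"
  unfolding rf_subst_def
proof (rule the_equality)
  show "\<exists>p' q'. q' \<noteq> 0 \<and> Fract p q = Fract p' q' \<and> poly_eval \<sigma> q' \<noteq> 0 \<and>
          poly_eval \<sigma> p / poly_eval \<sigma> q = poly_eval \<sigma> p' / poly_eval \<sigma> q'"
    using assms by blast
next
  fix y
  assume "\<exists>p' q'. q' \<noteq> 0 \<and> Fract p q = Fract p' q' \<and> poly_eval \<sigma> q' \<noteq> 0 \<and>
            y = poly_eval \<sigma> p' / poly_eval \<sigma> q'"
  then obtain p' q' where *: "q' \<noteq> 0" "Fract p q = Fract p' q'" "poly_eval \<sigma> q' \<noteq> 0"
      "y = poly_eval \<sigma> p' / poly_eval \<sigma> q'"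
    by blast
  then have "p * q' = p' * q"
    using assms(1) by (simp add: eq_fract)
  then have "poly_eval \<sigma> p * poly_eval \<sigma> q' = poly_eval \<sigma> p' * poly_eval \<sigma> q"
    by (metis poly_eval_mult)
  then show "y = poly_eval \<sigma> p / poly_eval \<sigma> q"
    using * assms by (simp add: frac_eq_eq)
qed

end

theory Submission
  imports Defs "HOL-Computational_Algebra.Polynomial"
begin

text \<open>Let \<open>G\<close> be the sum of all grapes, the empty one included.  Then \<open>x\<^sub>d \<psi>\<^sub>-\<^sub>1\<close> is the logarithm of \<open>G\<close>, that
  is, the coefficient of \<open>t\<close> in \<open>G\<^sup>t\<close>, whose component in each depth is a polynomial in \<open>t\<close>.  It
  therefore suffices to understand the powers \<open>G\<^sup>t\<close> for natural numbers \<open>t\<close>.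

  In the coordinates \<open>y\<^sub>i = x\<^sub>i - x\<^sub>i\<^sub>-\<^sub>1\<close> concatenation of vines is the concatenation product, \<open>G\<close> is
  group-like for the shuffle, hence so is \<open>G\<^sup>t\<close>, and the linear coefficient of a product of two
  polynomials without constant term vanishes; the factor \<open>1/x\<^sub>d = 1/(y\<^sub>1 + \<dots> + y\<^sub>d)\<close> is constant on a shuffle.

  For the stuffle, let the root of a vine be a variable \<open>r\<close> in place of \<open>0\<close>.  Then
  \<open>(x\<^sub>1, \<dots>, x\<^sub>d) \<mapsto> G\<^sup>t(x\<^sub>1; x\<^sub>2, \<dots>, x\<^sub>d)\<close>, with root \<open>x\<^sub>1\<close>, satisfies the stuffle equations modulo
  products, by induction on \<open>t\<close>.  This implies, again by induction on \<open>t\<close>, that dividing \<open>G\<^sup>t(r; \<dots>)\<close> by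
  \<open>x\<^sub>d - s\<close> multiplies its stuffle at \<open>v\<close>, \<open>w\<close> by \<open>(r - s)/((a - s)(b - s))\<close>, where \<open>a\<close>, \<open>b\<close> are the last letters
  of \<open>v\<close>, \<open>w\<close>.  At \<open>r = s = 0\<close> the stuffle of \<open>G\<^sup>t/x\<^sub>d\<close> vanishes for every \<open>t\<close>.\<close>

section \<open>Quasi-shuffle sums\<close>

text \<open>\<open>qsh \<kappa> \<Phi> v w\<close> is \<open>F(\<emptyset>; v * w)\<close> for the words of a field instead of words of indices.  The
  prefix \<open>u\<close> of \<open>F(u; v * w)\<close> is absorbed into \<open>\<Phi>\<close>, and the contraction term is scaled by \<open>\<kappa>\<close>, so
  that \<open>\<kappa> = 1\<close> gives the stuffle and \<open>\<kappa> = 0\<close> the shuffle sums.\<close>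


fun qsh :: "'a::field \<Rightarrow> ('a list \<Rightarrow> 'a) \<Rightarrow> 'a list \<Rightarrow> 'a list \<Rightarrow> 'a" where
  "qsh \<kappa> \<Phi> [] w = \<Phi> w"
| "qsh \<kappa> \<Phi> v [] = \<Phi> v"
| "qsh \<kappa> \<Phi> (a # v) (b # w) =
     qsh \<kappa> (\<lambda>z. \<Phi> (a # z)) v (b # w) + qsh \<kappa> (\<lambda>z. \<Phi> (b # z)) (a # v) w +
     \<kappa> * (qsh \<kappa> (\<lambda>z. \<Phi> (a # z)) v w - qsh \<kappa> (\<lambda>z. \<Phi> (b # z)) v w) / (a - b)"

lemma qsh_Nil2 [simp]: "qsh \<kappa> \<Phi> v [] = \<Phi> v"
  by (cases v) simp_all

lemma qsh_commute: "qsh \<kappa> \<Phi> v w = qsh \<kappa> \<Phi> w v"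
proof (induction \<kappa> \<Phi> v w rule: qsh.induct)
  case (3 \<kappa> \<Phi> a v b w)
  have "(x - y) / (a - b) = (y - x) / (b - a)" for x y
    by (metis minus_diff_eq minus_divide_divide)
  with 3 show ?case
    by (simp add: algebra_simps flip: times_divide_eq_right)
qed simp_all

lemma qsh_zero [simp]: "qsh \<kappa> (\<lambda>z. 0) v w = 0"
proof (induction \<kappa> "\<lambda>z::'a list. 0::'a" v w rule: qsh.induct)
qed simp_all

lemma qsh_add: "qsh \<kappa> (\<lambda>z. \<Phi> z + \<Psi> z) v w = qsh \<kappa> \<Phi> v w + qsh \<kappa> \<Psi> v w"
proof (induction \<kappa> \<Phi> v w arbitrary: \<Psi> rule: qsh.induct)
  case (3 \<kappa> \<Phi> a v b w)
  show ?case
    by (simp add: 3 add_divide_distrib diff_divide_distrib algebra_simps)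
qed simp_all

lemma qsh_scale: "qsh \<kappa> (\<lambda>z. s * \<Phi> z) v w = s * qsh \<kappa> \<Phi> v w"
proof (induction \<kappa> \<Phi> v w rule: qsh.induct)
  case (3 \<kappa> \<Phi> a v b w)
  show ?case
    by (simp add: 3 add_divide_distrib diff_divide_distrib algebra_simps)
qed simp_all

lemma qsh_divide: "qsh \<kappa> (\<lambda>z. \<Phi> z / s) v w = qsh \<kappa> \<Phi> v w / s"
  using qsh_scale[of \<kappa> "inverse s" \<Phi> v w] by (simp add: field_simps)

lemma qsh_sum: "qsh \<kappa> (\<lambda>z. \<Sum>j\<in>J. \<Phi> j z) v w = (\<Sum>j\<in>J. qsh \<kappa> (\<Phi> j) v w)"
  by (induction J rule: infinite_finite_induct) (simp_all add: qsh_add)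

text \<open>A contraction keeps one of its two letters, so \<open>\<Phi>\<close> is only evaluated
  at words without repetition in the given letters, and at the empty word only if both arguments are
  empty. Genericity conditions on the letters may thus be used when rewriting under
  \<open>qsh\<close>.\<close>

lemma qsh_cong:
  assumes "distinct (v @ w)"
    and "\<And>z. distinct z \<Longrightarrow> set z \<subseteq> set v \<union> set w \<Longrightarrow> length z \<le> length v + length w \<Longrightarrow>
           (z = [] \<Longrightarrow> v = [] \<and> w = []) \<Longrightarrow> \<Phi> z = \<Psi> z"
  shows "qsh \<kappa> \<Phi> v w = qsh \<kappa> \<Psi> v w"
  using assms
proof (induction \<kappa> \<Phi> v w arbitrary: \<Psi> rule: qsh.induct)
  case (3 \<kappa> \<Phi> a v b w)
  have "qsh \<kappa> (\<lambda>z. \<Phi> (a # z)) v (b # w) = qsh \<kappa> (\<lambda>z. \<Psi> (a # z)) v (b # w)"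
    by (rule "3.IH"(1)) (use "3.prems" in \<open>auto intro!: "3.prems"(2)\<close>)
  moreover have "qsh \<kappa> (\<lambda>z. \<Phi> (b # z)) (a # v) w = qsh \<kappa> (\<lambda>z. \<Psi> (b # z)) (a # v) w"
    by (rule "3.IH"(2)) (use "3.prems" in \<open>auto intro!: "3.prems"(2)\<close>)
  moreover have "qsh \<kappa> (\<lambda>z. \<Phi> (a # z)) v w = qsh \<kappa> (\<lambda>z. \<Psi> (a # z)) v w"
    by (rule "3.IH"(3)) (use "3.prems" in \<open>auto intro!: "3.prems"(2)\<close>)
  moreover have "qsh \<kappa> (\<lambda>z. \<Phi> (b # z)) v w = qsh \<kappa> (\<lambda>z. \<Psi> (b # z)) v w"
    by (rule "3.IH"(4)) (use "3.prems" in \<open>auto intro!: "3.prems"(2)\<close>)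
  ultimately show ?case by simp
next
  case (2 \<kappa> \<Phi> a v)
  show ?case by simp (rule "2.prems"(2), use "2.prems"(1) in auto)
qed simp_all

section \<open>Convolution along deconcatenation\<close>

definition conv :: "('a::field list \<Rightarrow> 'a) \<Rightarrow> ('a list \<Rightarrow> 'a) \<Rightarrow> 'a list \<Rightarrow> 'a" where
  "conv M N z = (\<Sum>i\<le>length z. M (take i z) * N (drop i z))"

lemma conv_Nil [simp]: "conv M N [] = M [] * N []"
  by (simp add: conv_def)

lemma conv_Cons: "conv M N (a # z) = M [] * N (a # z) + conv (\<lambda>u. M (a # u)) N z"
  by (simp add: conv_def sum.atMost_Suc_shift del: sum.atMost_Suc)

text \<open>The quasi-shuffle product is compatible with deconcatenation: cutting a word of the
  product cuts \<open>v\<close> and \<open>w\<close>, since every letter, contracted or not, lies on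
  one side of the cut.\<close>

lemma qsh_conv:
  "qsh \<kappa> (conv M N) v w =
     (\<Sum>i\<le>length v. \<Sum>j\<le>length w.
        qsh \<kappa> M (take i v) (take j w) * qsh \<kappa> N (drop i v) (drop j w))"
proof (induction \<kappa> M v w rule: qsh.induct)
  case (1 \<kappa> M w)
  show ?case by (simp add: conv_def)
next
  case (2 \<kappa> M a v)
  show ?case unfolding conv_def by simp
next
  case (3 \<kappa> M a v b w)
  let ?p = "length v" and ?q = "length w"
  let ?Q = "\<lambda>i j. qsh \<kappa> N (drop i v) (drop j w)"
  let ?Ma = "\<lambda>z. M (a # z)" and ?Mb = "\<lambda>z. M (b # z)"
  have s1: "(\<Sum>i\<le>length (a # v). f i) = f 0 + (\<Sum>i\<le>?p. f (Suc i))" for f :: "nat \<Rightarrow> 'a"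
    by (simp add: sum.atMost_Suc_shift del: sum.atMost_Suc)
  have s2: "(\<Sum>i\<le>length (b # w). f i) = f 0 + (\<Sum>i\<le>?q. f (Suc i))" for f :: "nat \<Rightarrow> 'a"
    by (simp add: sum.atMost_Suc_shift del: sum.atMost_Suc)
  \<comment> \<open>The cut before the first letter gives the terms with \<open>M []\<close>; all
    other cuts keep that letter in the left factor, where the induction hypothesis applies.\<close>
  have A: "qsh \<kappa> (conv M N) (a # v) (b # w) =
      M [] * qsh \<kappa> N (a # v) (b # w) + qsh \<kappa> (conv ?Ma N) v (b # w)
       + qsh \<kappa> (conv ?Mb N) (a # v) w
       + \<kappa> * (qsh \<kappa> (conv ?Ma N) v w - qsh \<kappa> (conv ?Mb N) v w) / (a - b)"
    by (simp add: conv_Cons qsh_add qsh_scale add_divide_distrib diff_divide_distrib algebra_simps)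
  show ?case
    unfolding A 3 s1 s2
    by (simp add: sum.distrib sum_divide_distrib sum_distrib_left sum_distrib_right
        sum_subtractf algebra_simps add_divide_distrib diff_divide_distrib)
qed

section \<open>Vines with variable root\<close>

text \<open>The grape \<open>g\<^sub>i\<close> attached to a vertex with variable \<open>r\<close> contributes \<open>crl r\<close> of its \<open>i\<close> variables.\<close>

definition crl :: "'a::field \<Rightarrow> 'a list \<Rightarrow> 'a" where
  "crl r z = prod_list (map (\<lambda>x. 1 / (x - r)) z)"

lemma crl_Nil [simp]: "crl r [] = 1"
  by (simp add: crl_def)

lemma crl_Cons [simp]: "crl r (x # z) = crl r z / (x - r)"
  by (simp add: crl_def)

lemma crl_append: "crl r (u @ z) = crl r u * crl r z"
  by (simp add: crl_def)

lemma crl_take_Suc: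
  assumes "i < length v"
  shows "crl r (take (Suc i) v) = crl r (take i v) / (v ! i - r)"
  using assms by (simp add: take_Suc_conv_app_nth crl_append)

text \<open>The grape is a character of the stuffle: the contraction contributes
  \<open>(1/(a - r) - 1/(b - r))/(a - b) = -1/((a - r)(b - r))\<close>, which cancels one of the two
  equal uncontracted terms.\<close>

lemma qsh_crl:
  assumes "distinct (r # v @ w)"
  shows "qsh 1 (crl r) v w = crl r v * crl r w"
  using assms
proof (induction "length v + length w" arbitrary: v w rule: less_induct)
  case less
  show ?case
  proof (cases "v = [] \<or> w = []")
    case False
    then obtain a v' b w' where vw: "v = a # v'" "w = b # w'"
      by (metis neq_Nil_conv)
    have *: "qsh 1 (\<lambda>z. crl r (x # z)) v1 w1 = crl r v1 * crl r w1 / (x - r)"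
      if "length v1 + length w1 < length v + length w" "distinct (r # v1 @ w1)" for x v1 w1
      using less.hyps[OF that] by (simp add: qsh_divide)
    have "a - r \<noteq> 0" "b - r \<noteq> 0" "a - b \<noteq> 0"
      using less.prems vw by auto
    moreover have "qsh 1 (\<lambda>z. crl r (a # z)) v' w = crl r v' * crl r w / (a - r)"
      "qsh 1 (\<lambda>z. crl r (b # z)) v w' = crl r v * crl r w' / (b - r)"
      "qsh 1 (\<lambda>z. crl r (a # z)) v' w' = crl r v' * crl r w' / (a - r)"
      "qsh 1 (\<lambda>z. crl r (b # z)) v' w' = crl r v' * crl r w' / (b - r)"
      by (rule *; use less.prems vw in auto)+
    ultimately show ?thesis
      unfolding vw by (simp del: crl_Cons) (simp add: divide_simps, simp add: algebra_simps)
  qed auto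
qed

text \<open>The default \<open>r\<close> serves the empty grape, which leaves the root
  unchanged.\<close>

primrec lst :: "'a \<Rightarrow> 'a list \<Rightarrow> 'a" where
  "lst r [] = r"
| "lst r (x # z) = lst x z"

lemma lst_append: "lst r (u @ z) = lst (lst r u) z"
  by (induction u arbitrary: r) simp_all

lemma lst_in: "lst r z \<in> insert r (set z)"
  by (induction z arbitrary: r) auto

lemma lst_take_Suc: "i < length v \<Longrightarrow> lst r (take (Suc i) v) = v ! i"
  by (simp add: take_Suc_conv_app_nth lst_append)

lemma lst_take_in: "lst r (take i v) \<in> insert r (set v)"
  using lst_in[of r "take i v"] set_take_subset[of i v] by auto

text \<open>Left multiplication by the sum of all grapes: a possibly empty grape at
  \<open>r\<close>, whose last vertex is the root of what follows.\<close>

definition extend :: "('a::field \<Rightarrow> 'a list \<Rightarrow> 'a) \<Rightarrow> 'a \<Rightarrow> 'a list \<Rightarrow> 'a" where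
  "extend \<Phi> r z = (\<Sum>i\<le>length z. crl r (take i z) * \<Phi> (lst r (take i z)) (drop i z))"

text \<open>In a quasi-shuffle, the root of what follows the first grape is the last letter of a prefix of \<open>v\<close>
  or of \<open>w\<close>, or a contraction of the two.  The signed count of these three cases collapses to \<open>kern\<close>;
  the letters \<open>x = y\<close> coincide only when both prefixes are empty.\<close>

definition kern :: "'a::field \<Rightarrow> 'a \<Rightarrow> 'a \<Rightarrow> ('a \<Rightarrow> 'a) \<Rightarrow> 'a" where
  "kern r x y g = (if x = y then g x else ((x - r) * g x - (y - r) * g y) / (x - y))"

lemma kern_commute: "kern r x y g = kern r y x g"
  by (cases "x = y") (auto simp: kern_def divide_simps algebra_simps)

lemma kern_root: "kern r x r g = g x"
  by (simp add: kern_def)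

text \<open>Once the empty grape is split off, the last letter of the first grape is handed to the
  right factor, where it is both first letter and root. This gives a genuine convolution, to which
  \<open>qsh_conv\<close> applies.\<close>

lemma extend_conv:
  "extend \<Phi> r z = \<Phi> r z + conv (crl r) (\<lambda>u. case u of [] \<Rightarrow> 0 | y # u' \<Rightarrow> \<Phi> y u' / (y - r)) z"
proof -
  have "crl r (take (Suc i) z) * \<Phi> (lst r (take (Suc i) z)) (drop (Suc i) z) =
     crl r (take i z) * (case drop i z of [] \<Rightarrow> 0 | y # u' \<Rightarrow> \<Phi> y u' / (y - r))"
    if "i < length z" for i
    using that by (simp add: crl_take_Suc lst_take_Suc flip: Cons_nth_drop_Suc)
  then show ?thesis
    unfolding extend_def conv_def
    by (subst sum.atMost_shift) (simp flip: lessThan_Suc_atMost)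
qed

text \<open>By \<open>extend_conv\<close>, \<open>qsh_conv\<close> and \<open>qsh_crl\<close> the
  left side becomes a sum over cuts of \<open>v\<close> and \<open>w\<close>. Expanding the right
  factor by its first letter, and letting the cuts absorb that letter, produces
  \<open>kern\<close>.\<close>

lemma qsh_extend:
  assumes "distinct (r # v @ w)"
  shows "qsh 1 (extend \<Phi> r) v w =
    (\<Sum>i\<le>length v. \<Sum>j\<le>length w. crl r (take i v) * crl r (take j w) *
       kern r (lst r (take i v)) (lst r (take j w))
         (\<lambda>x. qsh 1 (\<Phi> x) (drop i v) (drop j w)))"
proof -
  let ?p = "length v" and ?q = "length w"
  let ?c = "\<lambda>i j. crl r (take i v) * crl r (take j w)"
  let ?g = "\<lambda>x i j. qsh 1 (\<Phi> x) (drop i v) (drop j w)"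
  define \<Psi> where "\<Psi> = (\<lambda>u. case u of [] \<Rightarrow> 0 | y # u' \<Rightarrow> \<Phi> y u' / (y - r))"
  have [simp]: "\<Psi> [] = 0" "\<Psi> (y # u) = \<Phi> y u / (y - r)" for y u
    by (simp_all add: \<Psi>_def)
  have ne: "v ! i - r \<noteq> 0" if "i < ?p" for i
    using assms that nth_mem by fastforce
  have ne': "w ! j - r \<noteq> 0" if "j < ?q" for j
    using assms that nth_mem by fastforce
  have nevw: "v ! i - w ! j \<noteq> 0" if "i < ?p" "j < ?q" for i j
    using assms that by (auto simp: set_eq_iff) (metis nth_mem)
  define Z where "Z = (\<lambda>i j. ?c i j * qsh 1 \<Psi> (drop i v) (drop j w))"
  \<comment> \<open>The first letter after the cuts comes from \<open>v\<close> (\<open>L\<close>),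
    from \<open>w\<close> (\<open>R\<close>) or from a contraction (\<open>M\<close>).\<close>
  define L where "L = (\<lambda>i j. ?c (Suc i) j * ?g (v ! i) (Suc i) j)"
  define R where "R = (\<lambda>i j. ?c i (Suc j) * ?g (w ! j) i (Suc j))"
  define M where "M = (\<lambda>i j. ?c (Suc i) (Suc j) *
     ((w ! j - r) * ?g (v ! i) (Suc i) (Suc j) - (v ! i - r) * ?g (w ! j) (Suc i) (Suc j)) / (v ! i - w ! j))"
  have Z_in: "Z i j = L i j + R i j + M i j" if "i < ?p" "j < ?q" for i j
  proof -
    have d: "drop i v = v ! i # drop (Suc i) v" "drop j w = w ! j # drop (Suc j) w"
      using that by (simp_all add: Cons_nth_drop_Suc)
    show ?thesis
      unfolding Z_def L_def R_def M_def crl_take_Suc[OF that(1)] crl_take_Suc[OF that(2)]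
      using ne[OF that(1)] ne'[OF that(2)] nevw[OF that]
      unfolding d by (simp add: qsh_divide) (simp add: divide_simps, simp add: algebra_simps)
  qed
  have Z_v: "Z i ?q = L i ?q" if "i < ?p" for i
    using that unfolding Z_def L_def by (simp add: crl_take_Suc flip: Cons_nth_drop_Suc)
  have Z_w: "Z ?p j = R ?p j" if "j < ?q" for j
    using that unfolding Z_def R_def by (simp add: crl_take_Suc flip: Cons_nth_drop_Suc)
  have Z_0: "Z ?p ?q = 0"
    by (simp add: Z_def)
  have le: "(\<Sum>i\<le>n. f i) = (\<Sum>i<n. f i) + f n" for n and f :: "nat \<Rightarrow> 'a"
    by (simp flip: lessThan_Suc_atMost)
  have "(\<Sum>i\<le>?p. \<Sum>j\<le>?q. Z i j) =
     (\<Sum>i<?p. (\<Sum>j<?q. L i j + R i j + M i j) + L i ?q) + (\<Sum>j<?q. R ?p j)"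
    unfolding le by (simp add: Z_in Z_v Z_w Z_0)
  also have "\<dots> = (\<Sum>i<?p. \<Sum>j\<le>?q. L i j) + (\<Sum>i\<le>?p. \<Sum>j<?q. R i j) + (\<Sum>i<?p. \<Sum>j<?q. M i j)"
    unfolding le by (simp add: sum.distrib algebra_simps)
  also have "\<dots> = (\<Sum>i<?p. L i 0 + (\<Sum>j<?q. L i (Suc j))) + ((\<Sum>j<?q. R 0 j) + (\<Sum>i<?p. \<Sum>j<?q. R (Suc i) j))
      + (\<Sum>i<?p. \<Sum>j<?q. M i j)"
    unfolding sum.atMost_shift ..
  finally have sumZ: "(\<Sum>i\<le>?p. \<Sum>j\<le>?q. Z i j) =
      (\<Sum>i<?p. L i 0) + (\<Sum>j<?q. R 0 j) + (\<Sum>i<?p. \<Sum>j<?q. L i (Suc j) + R (Suc i) j + M i j)"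
    by (simp add: sum.distrib algebra_simps)
  define T where "T = (\<lambda>i j. ?c i j * kern r (lst r (take i v)) (lst r (take j w)) (\<lambda>x. ?g x i j))"
  have T1: "T (Suc i) 0 = L i 0" if "i < ?p" for i
    using that unfolding T_def L_def lst_take_Suc[OF that] by (simp add: kern_root)
  have T2: "T 0 (Suc j) = R 0 j" if "j < ?q" for j
    using that unfolding T_def R_def lst_take_Suc[OF that]
    by (subst kern_commute) (simp add: kern_root)
  \<comment> \<open>The cuts after \<open>v ! i\<close> and \<open>w ! j\<close> are reached in
    these three ways, and the coefficients add up to \<open>kern\<close>.\<close>
  have T3: "T (Suc i) (Suc j) = L i (Suc j) + R (Suc i) j + M i j" if "i < ?p" "j < ?q" for i j
  proof -
    have "kern r (v ! i) (w ! j) g = g (v ! i) + g (w ! j) +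
            ((w ! j - r) * g (v ! i) - (v ! i - r) * g (w ! j)) / (v ! i - w ! j)" for g
      using nevw[OF that] by (simp add: kern_def divide_simps) (simp add: algebra_simps)
    then show ?thesis
      unfolding T_def L_def R_def M_def lst_take_Suc[OF that(1)] lst_take_Suc[OF that(2)]
      by (simp add: algebra_simps)
  qed
  have "(\<Sum>i\<le>?p. \<Sum>j\<le>?q. T i j) = T 0 0 + (\<Sum>i\<le>?p. \<Sum>j\<le>?q. Z i j)"
    unfolding sumZ unfolding sum.atMost_shift
    by (simp add: T1 T2 T3 sum.distrib algebra_simps)
  \<comment> \<open>With both prefixes empty \<open>kern\<close> takes its branch
    \<open>x = y\<close>; this is the empty first grape.\<close>
  also have "T 0 0 = qsh 1 (\<Phi> r) v w"
    by (simp add: T_def kern_def)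
  also have "(\<Sum>i\<le>?p. \<Sum>j\<le>?q. Z i j) = qsh 1 (conv (crl r) \<Psi>) v w"
    unfolding qsh_conv Z_def
  proof (intro sum.cong refl)
    fix i j
    have "distinct (r # take i v @ take j w)"
      using assms by (auto dest: in_set_takeD)
    then show "?c i j * qsh 1 \<Psi> (drop i v) (drop j w) =
      qsh 1 (crl r) (take i v) (take j w) * qsh 1 \<Psi> (drop i v) (drop j w)"
      by (simp add: qsh_crl)
  qed
  also have "qsh 1 (\<Phi> r) v w + qsh 1 (conv (crl r) \<Psi>) v w = qsh 1 (extend \<Phi> r) v w"
    unfolding extend_conv[abs_def] \<Psi>_def qsh_add ..
  finally show ?thesis
    unfolding T_def by simp
qed

text \<open>\<open>vsum t r\<close> is the \<open>t\<close>-th power of the sum of all grapes (the empty one included), rooted at \<open>r\<close>; see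
  \<open>vsum_vines\<close>.\<close>

primrec vsum :: "nat \<Rightarrow> 'a::field \<Rightarrow> 'a list \<Rightarrow> 'a" where
  "vsum 0 = (\<lambda>r z. if z = [] then 1 else 0)"
| "vsum (Suc t) = extend (vsum t)"

lemma vsum_Nil [simp]: "vsum t r [] = 1"
  by (induction t arbitrary: r) (simp_all add: extend_def)

section \<open>Stuffle primitivity of the powers\<close>

lemma qsh_Nil_support:
  assumes "\<And>z. z \<noteq> [] \<Longrightarrow> \<Phi> z = 0" and "v \<noteq> [] \<or> w \<noteq> []"
  shows "qsh \<kappa> \<Phi> v w = 0"
  using assms by (cases v; cases w) simp_all

lemma distinct_lst:
  assumes "distinct (r # u @ z)"
  shows "distinct (lst r u # z)"
  using assms lst_in[of r u] by auto

lemma distinct_lst_take: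
  assumes "distinct (r # v @ w)"
  shows "distinct (lst r (take i v) # drop i v @ w)"
  using distinct_lst[of r "take i v" "drop i v @ w"] assms
  by (simp add: append_assoc[symmetric] del: append_assoc)

lemma distinct_lst_take2:
  assumes "distinct (r # v @ w)"
  shows "distinct (lst r (take i v) # drop i v @ drop j w)"
proof -
  have "distinct (drop j w)" "set (drop j w) \<subseteq> set w"
    using assms by (auto simp: set_drop_subset)
  then show ?thesis
    using distinct_lst_take[OF assms, of i] by auto
qed

lemma distinct_lst_take2':
  assumes "distinct (r # v @ w)"
  shows "distinct (lst r (take j w) # drop i v @ drop j w)"
proof -
  have "distinct (r # w @ v)" using assms by auto
  from distinct_lst_take2[OF this, of j i] show ?thesis by auto
qed

lemma lst_take_neq:
  assumes "distinct (a # v @ b # w)"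
  shows "lst a (take i v) \<noteq> lst b (take j w)"
  using assms lst_take_in[of a i v] lst_take_in[of b j w] by auto

text \<open>The stuffle equations for the words \<open>x # z \<mapsto> vsum t x z\<close>, whose first letter serves as the root.\<close>

definition vsum_primitive :: "nat \<Rightarrow> 'a::field itself \<Rightarrow> bool" where
  "vsum_primitive t _ \<longleftrightarrow> (\<forall>(a::'a) v b w. distinct (a # v @ b # w) \<longrightarrow>
     qsh 1 (vsum t a) v (b # w) + qsh 1 (vsum t b) (a # v) w +
       (qsh 1 (vsum t a) v w - qsh 1 (vsum t b) v w) / (a - b) = 0)"

text \<open>What is left of the primitivity equation at \<open>t + 1\<close> after the terms that cancel by the equation
  at \<open>t\<close>; the remainder is antisymmetric in its two words.\<close>

definition resid :: "nat \<Rightarrow> 'a::field \<Rightarrow> 'a list \<Rightarrow> 'a \<Rightarrow> 'a list \<Rightarrow> 'a" where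
  "resid t a v b w = (\<Sum>i\<le>length v. crl a (take i v) *
      qsh 1 (vsum t b) (lst a (take i v) # drop i v) w)"

text \<open>This is half of the primitivity equation at \<open>t + 1\<close>; exchanging the two
  words gives the other half. For each cut of \<open>v\<close>, the prefixes of \<open>b # w\<close>
  containing \<open>b\<close> and the prefixes of \<open>w\<close> together yield the contraction
  term of the equation at \<open>t\<close> with roots \<open>lst a (take i v)\<close> and
  \<open>b\<close>.\<close>

lemma vsum_Suc_resid:
  fixes a b :: "'a::field"
  assumes "vsum_primitive t TYPE('a)" and dist: "distinct (a # v @ b # w)"
  shows "qsh 1 (vsum (Suc t) a) v (b # w) + qsh 1 (vsum (Suc t) a) v w / (a - b) =
           - resid t a v b w"
proof -
  let ?p = "length v" and ?q = "length w"
  let ?\<alpha> = "\<lambda>i. lst a (take i v)"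
  let ?k = "\<lambda>i x j. kern a (?\<alpha> i) x (\<lambda>x. qsh 1 (vsum t x) (drop i v) (drop j w))"
  have ab: "a - b \<noteq> 0" "b - a \<noteq> 0" using dist by auto
  have dist': "distinct (a # v @ w)" using dist by auto
  have opp: "y / (b - a) * k + y * k / (a - b) = 0" for y k
    using ab by (simp add: divide_simps) (simp add: algebra_simps)
  have inner: "(\<Sum>j\<le>?q. crl a (b # take j w) * ?k i (lst b (take j w)) j)
      + (\<Sum>j\<le>?q. crl a (take j w) * ?k i (lst a (take j w)) j) / (a - b) =
      (qsh 1 (vsum t (?\<alpha> i)) (drop i v) w - qsh 1 (vsum t b) (drop i v) w) / (?\<alpha> i - b)" for i
  proof -
    let ?f = "\<lambda>j. crl a (b # take j w) * ?k i (lst b (take j w)) j"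
    let ?g = "\<lambda>j. crl a (take j w) * ?k i (lst a (take j w)) j"
    have "(\<Sum>j\<le>?q. ?f j) + (\<Sum>j\<le>?q. ?g j) / (a - b) =
        (?f 0 + ?g 0 / (a - b)) + (\<Sum>j<?q. ?f (Suc j) + ?g (Suc j) / (a - b))"
      unfolding sum.atMost_shift
      by (simp only: sum.distrib sum_divide_distrib add_divide_distrib ac_simps)
    \<comment> \<open>Prefixes with the same nonempty part of \<open>w\<close> have the same last
      letter and opposite factors \<open>1/(b - a)\<close> and \<open>1/(a - b)\<close>. Only
      \<open>j = 0\<close> survives, with last letters \<open>b\<close> and
      \<open>a\<close>.\<close>
    also have "(\<Sum>j<?q. ?f (Suc j) + ?g (Suc j) / (a - b)) = 0"
      by (intro sum.neutral ballI) (simp only: lst_take_Suc lessThan_iff crl_Cons opp)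
    finally have "(\<Sum>j\<le>?q. ?f j) + (\<Sum>j\<le>?q. ?g j) / (a - b) =
        crl a [b] * ?k i b 0 + ?k i a 0 / (a - b)"
      by simp
    also have "\<dots> = (qsh 1 (vsum t (?\<alpha> i)) (drop i v) w - qsh 1 (vsum t b) (drop i v) w) / (?\<alpha> i - b)"
    proof -
      have "?\<alpha> i - b \<noteq> 0" "?\<alpha> i \<noteq> b"
        using lst_take_neq[OF dist, of i 0] by simp_all
      then show ?thesis
        unfolding kern_root using ab
        by (simp add: kern_def) (simp add: divide_simps, simp add: algebra_simps)
    qed
    finally show ?thesis .
  qed
  have "qsh 1 (vsum (Suc t) a) v (b # w) =
    (\<Sum>i\<le>?p. crl a (take i v) * (qsh 1 (vsum t (?\<alpha> i)) (drop i v) (b # w) +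
       (\<Sum>j\<le>?q. crl a (b # take j w) * ?k i (lst b (take j w)) j)))"
    unfolding vsum.simps qsh_extend[OF dist] list.size add_0_right add_Suc_right
    by (intro sum.cong refl, subst sum.atMost_shift)
       (simp add: kern_root sum_distrib_left algebra_simps lessThan_Suc_atMost del: crl_Cons)
  moreover have "qsh 1 (vsum (Suc t) a) v w / (a - b) =
    (\<Sum>i\<le>?p. crl a (take i v) * ((\<Sum>j\<le>?q. crl a (take j w) * ?k i (lst a (take j w)) j) / (a - b)))"
    unfolding vsum.simps qsh_extend[OF dist']
    by (simp add: sum_distrib_left sum_divide_distrib algebra_simps)
  ultimately have "qsh 1 (vsum (Suc t) a) v (b # w) + qsh 1 (vsum (Suc t) a) v w / (a - b) =
     (\<Sum>i\<le>?p. crl a (take i v) * (qsh 1 (vsum t (?\<alpha> i)) (drop i v) (b # w) +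
       ((\<Sum>j\<le>?q. crl a (b # take j w) * ?k i (lst b (take j w)) j) +
        (\<Sum>j\<le>?q. crl a (take j w) * ?k i (lst a (take j w)) j) / (a - b))))"
    by (simp only: sum.distrib[symmetric] distrib_left add.assoc)
  also have "\<dots> = (\<Sum>i\<le>?p. - (crl a (take i v) * qsh 1 (vsum t b) (?\<alpha> i # drop i v) w))"
  proof (intro sum.cong refl)
    fix i
    have "qsh 1 (vsum t (?\<alpha> i)) (drop i v) (b # w) + qsh 1 (vsum t b) (?\<alpha> i # drop i v) w +
       (qsh 1 (vsum t (?\<alpha> i)) (drop i v) w - qsh 1 (vsum t b) (drop i v) w) / (?\<alpha> i - b) = 0"
      using assms(1) distinct_lst_take[OF dist, of i] unfolding vsum_primitive_def by blast
    then have e: "qsh 1 (vsum t (?\<alpha> i)) (drop i v) (b # w) +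
       (qsh 1 (vsum t (?\<alpha> i)) (drop i v) w - qsh 1 (vsum t b) (drop i v) w) / (?\<alpha> i - b) =
       - qsh 1 (vsum t b) (?\<alpha> i # drop i v) w"
      by (simp only: eq_neg_iff_add_eq_0 ac_simps)
    show "crl a (take i v) * (qsh 1 (vsum t (?\<alpha> i)) (drop i v) (b # w) +
       ((\<Sum>j\<le>?q. crl a (b # take j w) * ?k i (lst b (take j w)) j) +
        (\<Sum>j\<le>?q. crl a (take j w) * ?k i (lst a (take j w)) j) / (a - b))) =
       - (crl a (take i v) * qsh 1 (vsum t b) (?\<alpha> i # drop i v) w)"
      unfolding inner e by simp
  qed
  finally show ?thesis
    by (simp only: resid_def sum_negf)
qed

text \<open>Telescoping, by partial fractions in the two roots.\<close>

lemma crl_two_roots: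
  assumes "distinct (a # b # u)"
  shows "(\<Sum>i\<le>length u. crl a (take i u) * crl b (lst a (take i u) # drop i u)) = crl a u / (a - b)"
  using assms
proof (induction u rule: rev_induct)
  case (snoc x u)
  have ne: "x - a \<noteq> 0" "x - b \<noteq> 0" "a - b \<noteq> 0"
    using snoc.prems by auto
  have "(\<Sum>i\<le>length (u @ [x]). crl a (take i (u @ [x])) * crl b (lst a (take i (u @ [x])) # drop i (u @ [x]))) =
    (\<Sum>i\<le>length u. crl a (take i u) * crl b (lst a (take i u) # drop i u)) / (x - b)
      + crl a (u @ [x]) * crl b [x]"
    by (simp add: crl_append lst_append sum_divide_distrib mult.commute)
  also have "\<dots> = crl a (u @ [x]) / (a - b)"
    using snoc ne by (simp add: crl_append divide_simps) (simp add: algebra_simps)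
  finally show ?case .
qed simp

text \<open>The first grape at \<open>b\<close> is expanded in every summand of
  \<open>resid\<close>. If it takes letters of its first word, it reaches a cut of \<open>v\<close>
  at some \<open>m\<close>, and the sum over the places \<open>i <= m\<close> where the grape at
  \<open>a\<close> ends is evaluated by \<open>crl_two_roots\<close>.\<close>

lemma resid_Suc:
  fixes a b :: "'a::field"
  assumes dist: "distinct (a # v @ b # w)"
  shows "resid (Suc t) a v b w = (\<Sum>i\<le>length v. \<Sum>j\<le>length w. crl a (take i v) * crl b (take j w) *
     (qsh 1 (vsum t (lst b (take j w))) (lst a (take i v) # drop i v) (drop j w) +
      kern b (lst a (take i v)) (lst b (take j w)) (\<lambda>x. qsh 1 (vsum t x) (drop i v) (drop j w)) / (a - b)))"
proof -
  let ?p = "length v" and ?q = "length w"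
  let ?\<alpha> = "\<lambda>i. lst a (take i v)" and ?\<beta> = "\<lambda>j. lst b (take j w)"
  let ?K = "\<lambda>m. \<Sum>j\<le>?q. crl b (take j w) *
     kern b (?\<alpha> m) (?\<beta> j) (\<lambda>x. qsh 1 (vsum t x) (drop m v) (drop j w))"
  \<comment> \<open>The grape at \<open>b\<close> either avoids \<open>?\<alpha> i\<close> or takes
    it with \<open>k\<close> further letters of \<open>v\<close>.\<close>
  have *: "qsh 1 (vsum (Suc t) b) (?\<alpha> i # drop i v) w =
      (\<Sum>j\<le>?q. crl b (take j w) * qsh 1 (vsum t (?\<beta> j)) (?\<alpha> i # drop i v) (drop j w))
       + (\<Sum>k\<le>?p - i. crl b (?\<alpha> i # take k (drop i v)) * ?K (i + k))" if "i \<le> ?p" for i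
  proof -
    have "distinct (b # (?\<alpha> i # drop i v) @ w)"
      using distinct_lst_take[OF dist, of i] by auto
    note q = qsh_extend[OF this]
    have l: "lst (?\<alpha> i) (take k (drop i v)) = ?\<alpha> (i + k)" for k
      by (simp add: take_add lst_append)
    show ?thesis
      unfolding vsum.simps q list.size add_0_right add_Suc_right
      by (subst sum.atMost_shift)
        (simp add: kern_root kern_commute[of b b] sum_distrib_left l algebra_simps lessThan_Suc_atMost
            del: crl_Cons)
  qed
  have "resid (Suc t) a v b w =
     (\<Sum>i\<le>?p. \<Sum>j\<le>?q. crl a (take i v) * crl b (take j w) * qsh 1 (vsum t (?\<beta> j)) (?\<alpha> i # drop i v) (drop j w))
     + (\<Sum>i\<le>?p. \<Sum>k\<le>?p - i. crl a (take i v) * crl b (?\<alpha> i # take k (drop i v)) * ?K (i + k))"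
    unfolding resid_def by (simp add: * sum.distrib sum_distrib_left algebra_simps del: vsum.simps crl_Cons)
  \<comment> \<open>Exchange of summation with \<open>m = i + k\<close>; the factor
    \<open>?K\<close> sees only \<open>m\<close>.\<close>
  also have "(\<Sum>i\<le>?p. \<Sum>k\<le>?p - i. crl a (take i v) * crl b (?\<alpha> i # take k (drop i v)) * ?K (i + k)) =
      (\<Sum>m\<le>?p. \<Sum>i\<le>m. crl a (take i v) * crl b (?\<alpha> i # take (m - i) (drop i v)) * ?K m)"
  proof -
    have e: "(SIGMA i:{..?p}. {..?p - i}) = {(i, k). i + k \<le> ?p}" by auto
    show ?thesis
      by (simp add: sum.Sigma e sum.triangle_reindex_eq)
  qed
  also have "\<dots> = (\<Sum>m\<le>?p. crl a (take m v) / (a - b) * ?K m)"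
  proof (intro sum.cong refl)
    fix m assume m: "m \<in> {..?p}"
    have "distinct (a # b # take m v)"
      using dist by (auto dest: in_set_takeD)
    have "(\<Sum>i\<le>m. crl a (take i v) * crl b (?\<alpha> i # take (m - i) (drop i v))) =
        (\<Sum>i\<le>length (take m v). crl a (take i (take m v)) * crl b (lst a (take i (take m v)) # drop i (take m v)))"
      using m by (intro sum.cong) (auto simp: drop_take min_absorb1 min_absorb2 simp del: crl_Cons)
    also have "\<dots> = crl a (take m v) / (a - b)"
      by (rule crl_two_roots) fact
    finally have "(\<Sum>i\<le>m. crl a (take i v) * crl b (?\<alpha> i # take (m - i) (drop i v))) = crl a (take m v) / (a - b)" .
    then show "(\<Sum>i\<le>m. crl a (take i v) * crl b (?\<alpha> i # take (m - i) (drop i v)) * ?K m) =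
        crl a (take m v) / (a - b) * ?K m"
      unfolding sum_distrib_right[symmetric] by simp
  qed
  also have "(\<Sum>i\<le>?p. \<Sum>j\<le>?q. crl a (take i v) * crl b (take j w) * qsh 1 (vsum t (?\<beta> j)) (?\<alpha> i # drop i v) (drop j w)) + \<dots> =
    (\<Sum>i\<le>?p. \<Sum>j\<le>?q. crl a (take i v) * crl b (take j w) *
      (qsh 1 (vsum t (?\<beta> j)) (?\<alpha> i # drop i v) (drop j w) +
       kern b (?\<alpha> i) (?\<beta> j) (\<lambda>x. qsh 1 (vsum t x) (drop i v) (drop j w)) / (a - b)))"
    by (simp add: sum_distrib_left sum.distrib[symmetric] distrib_left mult.assoc)
  finally show ?thesis .
qed

text \<open>By \<open>resid_Suc\<close> both residues are sums over the same cuts with the same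
  weights, and they cancel term by term: the two \<open>kern\<close> terms add up to the contraction
  term of the primitivity equation at \<open>t\<close> for the roots \<open>lst a (take i v)\<close>
  and \<open>lst b (take j w)\<close>.\<close>

lemma resid_antisym:
  fixes a b :: "'a::field"
  assumes "vsum_primitive t TYPE('a)" and dist: "distinct (a # v @ b # w)"
  shows "resid (Suc t) a v b w + resid (Suc t) b w a v = 0"
proof -
  let ?p = "length v" and ?q = "length w"
  let ?\<alpha> = "\<lambda>i. lst a (take i v)" and ?\<beta> = "\<lambda>j. lst b (take j w)"
  have dist': "distinct (b # w @ a # v)" using dist by auto
  have "resid (Suc t) b w a v = (\<Sum>i\<le>?p. \<Sum>j\<le>?q. crl b (take j w) * crl a (take i v) *
     (qsh 1 (vsum t (?\<alpha> i)) (?\<beta> j # drop j w) (drop i v) +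
      kern a (?\<beta> j) (?\<alpha> i) (\<lambda>x. qsh 1 (vsum t x) (drop j w) (drop i v)) / (b - a)))"
    unfolding resid_Suc[OF dist'] by (rule sum.swap)
  also have "resid (Suc t) a v b w + \<dots> = (\<Sum>i\<le>?p. \<Sum>j\<le>?q. 0)"
    unfolding resid_Suc[OF dist] sum.distrib[symmetric]
  proof (intro sum.cong refl)
    fix i j
    let ?g = "\<lambda>x. qsh 1 (vsum t x) (drop i v) (drop j w)"
    have d: "distinct (?\<alpha> i # drop i v @ ?\<beta> j # drop j w)"
    proof -
      have "distinct (?\<beta> j # drop j w @ a # v)"
        by (rule distinct_lst_take[OF dist'])
      then have "distinct (a # v @ ?\<beta> j # drop j w)"
        unfolding distinct_append distinct.simps list.set set_append by blast
      then show ?thesis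
        by (rule distinct_lst_take)
    qed
    have e: "qsh 1 (vsum t (?\<alpha> i)) (drop i v) (?\<beta> j # drop j w) =
       - (qsh 1 (vsum t (?\<beta> j)) (?\<alpha> i # drop i v) (drop j w) + (?g (?\<alpha> i) - ?g (?\<beta> j)) / (?\<alpha> i - ?\<beta> j))"
      using assms(1)[unfolded vsum_primitive_def, rule_format, OF d]
      by (simp only: eq_neg_iff_add_eq_0 add.assoc)
    have ne: "?\<alpha> i - ?\<beta> j \<noteq> 0" "?\<beta> j - ?\<alpha> i \<noteq> 0" "a - b \<noteq> 0" "b - a \<noteq> 0"
      using d dist by auto
    have k: "kern b x y g / (a - b) + kern a x y g / (b - a) = (g x - g y) / (x - y)"
      if "x - y \<noteq> 0" for x y g
      using ne that by (simp add: kern_def) (simp add: divide_simps, simp add: algebra_simps)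
    have alg: "A * B * (Y + K) + B * A * (- (Y + (K + L)) + L) = 0" for A B Y K L :: 'a
      by (simp add: algebra_simps)
    show "crl a (take i v) * crl b (take j w) *
       (qsh 1 (vsum t (?\<beta> j)) (?\<alpha> i # drop i v) (drop j w) + kern b (?\<alpha> i) (?\<beta> j) ?g / (a - b)) +
      crl b (take j w) * crl a (take i v) *
       (qsh 1 (vsum t (?\<alpha> i)) (?\<beta> j # drop j w) (drop i v) +
        kern a (?\<beta> j) (?\<alpha> i) (\<lambda>x. qsh 1 (vsum t x) (drop j w) (drop i v)) / (b - a)) = 0"
      unfolding qsh_commute[of _ _ _ "drop i v"] e kern_commute[of a "?\<beta> j"]
        k[OF ne(1), of ?g, symmetric]
      by (rule alg)
  qed
  finally show ?thesis by simp
qed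

text \<open>The induction carries the antisymmetry of \<open>resid t\<close> along: primitivity at
  \<open>t + 1\<close> follows from both statements at \<open>t\<close>, antisymmetry at
  \<open>t + 1\<close> from primitivity at \<open>t\<close>.\<close>

lemma vsum_primitive_holds: "vsum_primitive t TYPE('a::field)"
proof -
  have "vsum_primitive t TYPE('a) \<and>
    (\<forall>(a::'a) v b w. distinct (a # v @ b # w) \<longrightarrow> resid t a v b w + resid t b w a v = 0)"
  proof (induction t)
    case 0
    show ?case
    proof -
      have "qsh 1 (vsum 0 a) v w = 0" if "v \<noteq> [] \<or> w \<noteq> []" for a :: 'a and v w
        using that by (intro qsh_Nil_support) simp_all
      moreover have "qsh 1 (vsum 0 a) v w = qsh 1 (vsum 0 b) v w" for a b :: 'a and v w
        by simp
      ultimately show ?thesis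
        by (simp add: vsum_primitive_def resid_def del: vsum.simps)
    qed
  next
    case (Suc t)
    have "vsum_primitive (Suc t) TYPE('a)"
      unfolding vsum_primitive_def
    proof (intro allI impI)
      fix a :: 'a and v b w assume d: "distinct (a # v @ b # w)"
      then have d': "distinct (b # w @ a # v)" by auto
      have alg: "p + p' + (q - q') / (a - b) = 0"
        if "p + q / (a - b) = - R" "p' + q' / (b - a) = - R'" "R + R' = 0" for p p' q q' R R'
      proof -
        have "q' / (b - a) = - (q' / (a - b))"
          by (metis minus_diff_eq minus_divide_right)
        then have "p + p' + (q - q') / (a - b) = (p + q / (a - b)) + (p' + q' / (b - a))"
          by (simp add: diff_divide_distrib)
        also have "\<dots> = - (R + R')"
          unfolding that(1,2) by simp
        finally show ?thesis
          using that(3) by simp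
      qed
      show "qsh 1 (vsum (Suc t) a) v (b # w) + qsh 1 (vsum (Suc t) b) (a # v) w +
         (qsh 1 (vsum (Suc t) a) v w - qsh 1 (vsum (Suc t) b) v w) / (a - b) = 0"
        unfolding qsh_commute[of 1 "vsum (Suc t) b" _ w]
        by (rule alg[OF vsum_Suc_resid[OF conjunct1[OF Suc] d] vsum_Suc_resid[OF conjunct1[OF Suc] d']])
          (rule conjunct2[OF Suc, rule_format, OF d])
    qed
    moreover have "\<forall>(a::'a) v b w. distinct (a # v @ b # w) \<longrightarrow>
        resid (Suc t) a v b w + resid (Suc t) b w a v = 0"
      by (intro allI impI resid_antisym conjunct1[OF Suc])
    ultimately show ?case by (rule conjI)
  qed
  then show ?thesis ..
qed

section \<open>Stuffle equations\<close>

text \<open>In \<open>extend_conv\<close> the weight \<open>x - r\<close> removes the empty first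
  grape and cancels the denominator \<open>y - r\<close>, so that the function of
  \<open>vsum_primitive\<close> becomes the right factor.\<close>

definition vroot :: "nat \<Rightarrow> 'a \<Rightarrow> 'a::field \<Rightarrow> 'a list \<Rightarrow> 'a" where
  "vroot t r x z = (x - r) * vsum t x z"

definition vlast :: "nat \<Rightarrow> 'a \<Rightarrow> 'a::field \<Rightarrow> 'a list \<Rightarrow> 'a" where
  "vlast t s x z = vsum t x z / (lst x z - s)"

lemma qsh_vroot_letters:
  fixes a b r :: "'a::field"
  assumes dist: "distinct (r # a # v @ b # w)"
  shows "qsh 1 (case_list 0 (\<lambda>y. vsum t y)) (a # v) (b # w) = 0"
  using vsum_primitive_holds[of t, where ?'a = 'a] dist unfolding vsum_primitive_def by simp

text \<open>A stuffle character is convolved with a primitive function: the quasi-shuffle of the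
  right factor vanishes unless the cuts exhaust \<open>v\<close> or \<open>w\<close>, which leaves
  the two products.\<close>

lemma qsh_extend_vroot:
  assumes dist: "distinct (r # v @ w)"
  shows "qsh 1 (extend (vroot t r) r) v w =
    crl r v * extend (vroot t r) r w + crl r w * extend (vroot t r) r v"
proof -
  let ?B = "case_list 0 (\<lambda>y. vsum t y)"
  let ?p = "length v" and ?q = "length w"
  have conv: "extend (vroot t r) r z = conv (crl r) ?B z" if "r \<notin> set z" for z
  proof -
    have "extend (vroot t r) r z = conv (crl r) (\<lambda>u. case u of [] \<Rightarrow> 0 | y # u' \<Rightarrow> vroot t r y u' / (y - r)) z"
      unfolding extend_conv by (simp add: vroot_def[of t r r])
    also have "\<dots> = conv (crl r) ?B z"
      unfolding conv_def
    proof (intro sum.cong refl arg_cong2[where f = times])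
      fix i
      have "set (drop i z) \<subseteq> set z" by (rule set_drop_subset)
      with that show "(case drop i z of [] \<Rightarrow> 0 | y # u' \<Rightarrow> vroot t r y u' / (y - r)) = ?B (drop i z)"
        by (auto simp: vroot_def split: list.split)
    qed
    finally show ?thesis .
  qed
  have "qsh 1 (extend (vroot t r) r) v w = qsh 1 (conv (crl r) ?B) v w"
    by (rule qsh_cong) (use dist in \<open>auto intro!: conv\<close>)
  also have "\<dots> = (\<Sum>i\<le>?p. \<Sum>j\<le>?q.
      (if i = ?p then crl r v * (crl r (take j w) * ?B (drop j w)) else 0) +
      (if j = ?q then crl r w * (crl r (take i v) * ?B (drop i v)) else 0))"
    unfolding qsh_conv
  proof (intro sum.cong refl)
    fix i j assume ij: "i \<in> {..?p}" "j \<in> {..?q}"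
    have "distinct (r # take i v @ take j w)"
      using dist by (auto dest: in_set_takeD)
    then have c: "qsh 1 (crl r) (take i v) (take j w) = crl r (take i v) * crl r (take j w)"
      by (rule qsh_crl)
    have "qsh 1 ?B (drop i v) (drop j w) = 0" if "i < ?p" "j < ?q"
    proof -
      have "distinct (r # drop i v @ drop j w)"
        using dist by (auto dest: in_set_dropD)
      then show ?thesis
        unfolding Cons_nth_drop_Suc[OF that(1), symmetric] Cons_nth_drop_Suc[OF that(2), symmetric]
          append_Cons by (rule qsh_vroot_letters)
    qed
    then show "qsh 1 (crl r) (take i v) (take j w) * qsh 1 ?B (drop i v) (drop j w) =
      (if i = ?p then crl r v * (crl r (take j w) * ?B (drop j w)) else 0) +
      (if j = ?q then crl r w * (crl r (take i v) * ?B (drop i v)) else 0)"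
      unfolding c using ij by auto
  qed
  also have "\<dots> = (\<Sum>j\<le>?q. \<Sum>i\<le>?p. if i = ?p then crl r v * (crl r (take j w) * ?B (drop j w)) else 0) +
     (\<Sum>i\<le>?p. \<Sum>j\<le>?q. if j = ?q then crl r w * (crl r (take i v) * ?B (drop i v)) else 0)"
    unfolding sum.distrib by (subst sum.swap) simp
  also have "\<dots> = crl r v * conv (crl r) ?B w + crl r w * conv (crl r) ?B v"
    by (simp add: conv_def sum_distrib_left)
  also have "\<dots> = crl r v * extend (vroot t r) r w + crl r w * extend (vroot t r) r v"
    using dist by (simp add: conv)
  finally show ?thesis .
qed

lemma vlast_Suc: "vlast (Suc t) s r z = extend (vlast t s) r z"
  unfolding vlast_def vsum.simps extend_def sum_divide_distrib
  by (intro sum.cong refl) (metis append_take_drop_id lst_append times_divide_eq_right)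

text \<open>For \<open>r = s\<close> this is the required vanishing, but the induction on \<open>t\<close> needs all roots \<open>r\<close>.  The
  discrepancy between the two sides obeys \<open>qsh_extend_vroot\<close>.\<close>

lemma qsh_vlast:
  assumes "distinct (r # v @ w)" "s \<notin> set v \<union> set w" "v \<noteq> []" "w \<noteq> []"
  shows "(lst r v - s) * (lst r w - s) * qsh 1 (vlast t s r) v w = (r - s) * qsh 1 (vsum t r) v w"
  using assms
proof (induction t arbitrary: r v w)
  case 0
  have "qsh 1 (vlast 0 s r) v w = 0" "qsh 1 (vsum 0 r) v w = 0"
    using 0 by (auto intro!: qsh_Nil_support simp: vlast_def)
  then show ?case by (simp del: vsum.simps)
next
  case (Suc t)
  note dist = Suc.prems(1)
  let ?p = "length v" and ?q = "length w"
  let ?\<alpha> = "\<lambda>i. lst r (take i v)" and ?\<beta> = "\<lambda>j. lst r (take j w)"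
  let ?c = "\<lambda>i j. crl r (take i v) * crl r (take j w)"
  let ?k = "\<lambda>\<Phi> i j. kern r (?\<alpha> i) (?\<beta> j) (\<lambda>x. qsh 1 (\<Phi> x) (drop i v) (drop j w))"
  let ?V = "\<lambda>i. vroot t r (?\<alpha> i) (drop i v)" and ?W = "\<lambda>j. vroot t r (?\<beta> j) (drop j w)"
  define a b where "a = lst r v" and "b = lst r w"
  have a: "a \<in> set v" and b: "b \<in> set w"
    using Suc.prems lst_in[of _ "tl v"] lst_in[of _ "tl w"]
    by (cases v; cases w; force simp: a_def b_def)+
  have as: "a - s \<noteq> 0" and bs: "b - s \<noteq> 0"
    using Suc.prems a b by auto
  \<comment> \<open>With letters left in both words the induction hypothesis applies at both roots,
    and \<open>vroot\<close> arises from \<open>(x - s) - (r - s) = x - r\<close>. If a word is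
    exhausted, direct computation leaves the extra terms \<open>?W\<close> and
    \<open>?V\<close>.\<close>
  have key: "(a - s) * (b - s) * ?k (vlast t s) i j - (r - s) * ?k (vsum t) i j =
       ?k (vroot t r) i j - (if i = ?p then ?W j else 0) - (if j = ?q then ?V i else 0)"
    if ij: "i \<le> ?p" "j \<le> ?q" for i j
  proof -
    have la: "lst (?\<alpha> i) (drop i v) = a" and lb: "lst (?\<beta> j) (drop j w) = b"
      by (simp_all add: a_def b_def flip: lst_append)
    have vr: "qsh 1 (vroot t r x) (drop i v) (drop j w) = (x - r) * qsh 1 (vsum t x) (drop i v) (drop j w)" for x
      by (simp add: vroot_def[abs_def] qsh_scale)
    consider "i < ?p" "j < ?q" | "i = ?p" "j < ?q" | "i < ?p" "j = ?q" | "i = ?p" "j = ?q"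
      using ij by linarith
    then show ?thesis
    proof cases
      case 1
      have l: "lst x (drop i v) = a" "lst x (drop j w) = b" for x
        using 1 la lb by (simp_all flip: Cons_nth_drop_Suc)
      have s: "s \<notin> set (drop i v) \<union> set (drop j w)"
        using Suc.prems(2) by (auto dest: in_set_dropD)
      have *: "(a - s) * (b - s) * qsh 1 (vlast t s x) (drop i v) (drop j w) =
          (x - s) * qsh 1 (vsum t x) (drop i v) (drop j w)" if "x = ?\<alpha> i \<or> x = ?\<beta> j" for x
      proof -
        have "distinct (x # drop i v @ drop j w)"
          using that distinct_lst_take2[OF dist] distinct_lst_take2'[OF dist] by blast
        from Suc.IH[OF this s] 1 show ?thesis by (simp add: l)
      qed
      have k: "A * kern r x y f - B * kern r x y g = kern r x y h"
        if "A * f x = (x - s) * g x" "A * f y = (y - s) * g y" "B = r - s"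
          "h x = (x - r) * g x" "h y = (y - r) * g y" for A B x y f g h
      proof (cases "x = y")
        case True
        then show ?thesis by (simp add: kern_def that(2,3,5) left_diff_distrib)
      next
        case False
        have "A * ((x - r) * f x - (y - r) * f y) =
            (x - r) * ((x - s) * g x) - (y - r) * ((y - s) * g y)"
          unfolding that(1,2)[symmetric] by (simp add: algebra_simps)
        then have "A * kern r x y f = ((x - r) * ((x - s) * g x) - (y - r) * ((y - s) * g y)) / (x - y)"
          using False by (simp add: kern_def)
        then show ?thesis
          using False that(3-5) by (simp add: kern_def divide_simps) (simp add: algebra_simps)
      qed
      have "(a - s) * (b - s) * ?k (vlast t s) i j - (r - s) * ?k (vsum t) i j = ?k (vroot t r) i j"
        by (rule k) (auto simp: * vr)
      then show ?thesis
        using 1 by simp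
    next
      case 2
      have i: "?\<alpha> i = a" "drop i v = []" using 2 by (simp_all add: a_def)
      have nab: "a \<noteq> ?\<beta> j"
        using a dist lst_in[of r "take j w"] set_take_subset[of j w] by auto
      have l: "lst x (drop j w) = b" for x
        using 2 lb by (simp flip: Cons_nth_drop_Suc)
      have k: "(a - s) * (b - s) * kern r a y (\<lambda>x. f x / (b - s)) - (r - s) * kern r a y f =
         kern r a y (\<lambda>x. (x - r) * f x) - (y - r) * f y" if "a \<noteq> y" for y f
        using that bs by (simp add: kern_def divide_simps) (simp add: algebra_simps)
      show ?thesis
        using 2 k[OF nab, of "\<lambda>x. vsum t x (drop j w)"] unfolding i
        by (simp add: vlast_def l vroot_def)
    next
      case 3
      have i: "?\<beta> j = b" "drop j w = []" using 3 by (simp_all add: b_def)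
      have nab: "?\<alpha> i \<noteq> b"
        using b dist lst_in[of r "take i v"] set_take_subset[of i v] by auto
      have l: "lst x (drop i v) = a" for x
        using 3 la by (simp flip: Cons_nth_drop_Suc)
      have k: "(a - s) * (b - s) * kern r y b (\<lambda>x. f x / (a - s)) - (r - s) * kern r y b f =
         kern r y b (\<lambda>x. (x - r) * f x) - (y - r) * f y" if "y \<noteq> b" for y f
        using that as by (simp add: kern_def divide_simps) (simp add: algebra_simps)
      show ?thesis
        using 3 k[OF nab, of "\<lambda>x. vsum t x (drop i v)"] unfolding i
        by (simp add: vlast_def l vroot_def)
    next
      case 4
      have i: "?\<alpha> i = a" "drop i v = []" "?\<beta> j = b" "drop j w = []"
        using 4 by (simp_all add: a_def b_def)
      have nab: "a \<noteq> b" using a b dist by auto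
      show ?thesis
        unfolding i using 4 nab as bs
        by (simp add: vlast_def vroot_def kern_def divide_simps) (simp add: algebra_simps)
    qed
  qed
  have lin: "A * (\<Sum>i\<le>?p. \<Sum>j\<le>?q. c i j * F i j) - B * (\<Sum>i\<le>?p. \<Sum>j\<le>?q. c i j * G i j) =
      (\<Sum>i\<le>?p. \<Sum>j\<le>?q. c i j * (A * F i j - B * G i j))" for A B and c F G :: "nat \<Rightarrow> nat \<Rightarrow> 'a"
    by (simp add: sum_distrib_left sum_subtractf right_diff_distrib mult.left_commute)
  have "(a - s) * (b - s) * qsh 1 (vlast (Suc t) s r) v w - (r - s) * qsh 1 (vsum (Suc t) r) v w =
     (\<Sum>i\<le>?p. \<Sum>j\<le>?q. ?c i j * ((a - s) * (b - s) * ?k (vlast t s) i j - (r - s) * ?k (vsum t) i j))"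
    unfolding vlast_Suc[abs_def] vsum.simps qsh_extend[OF dist]
    by (rule lin)
  also have "\<dots> = (\<Sum>i\<le>?p. \<Sum>j\<le>?q. ?c i j * ?k (vroot t r) i j
      - (if i = ?p then ?c i j * ?W j else 0) - (if j = ?q then ?c i j * ?V i else 0))"
    by (intro sum.cong refl) (subst key, auto simp: algebra_simps)
  also have "\<dots> = qsh 1 (extend (vroot t r) r) v w
      - (\<Sum>j\<le>?q. \<Sum>i\<le>?p. if i = ?p then ?c i j * ?W j else 0)
      - (\<Sum>i\<le>?p. \<Sum>j\<le>?q. if j = ?q then ?c i j * ?V i else 0)"
    unfolding qsh_extend[OF dist] sum_subtractf by (subst (2) sum.swap) simp
  \<comment> \<open>The extra terms sum to the two products in
    \<open>qsh_extend_vroot\<close>.\<close>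
  also have "\<dots> = 0"
    unfolding qsh_extend_vroot[OF dist] by (simp add: extend_def sum_distrib_left algebra_simps)
  finally show ?case
    by (simp add: a_def b_def)
qed

lemma stuffle_vlast:
  fixes s :: "'a::field"
  assumes "distinct (s # v @ w)" "v \<noteq> []" "w \<noteq> []"
  shows "qsh 1 (vlast t s s) v w = 0"
proof -
  have "lst s v \<noteq> s" "lst s w \<noteq> s"
    using assms lst_in[of _ "tl v"] lst_in[of _ "tl w"] by (cases v; cases w; force)+
  then show ?thesis
    using qsh_vlast[of s v w s t] assms by auto
qed

section \<open>Shuffle equations\<close>

text \<open>The passage from the differences \<open>y_i\<close> back to the variables
  \<open>x_i\<close>, with \<open>x_0 = r\<close>.\<close>

primrec psums :: "'a::monoid_add \<Rightarrow> 'a list \<Rightarrow> 'a list" where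
  "psums r [] = []"
| "psums r (y # z) = (r + y) # psums (r + y) z"

lemma length_psums [simp]: "length (psums r z) = length z"
  by (induction z arbitrary: r) simp_all

lemma psums_append: "psums r (u @ z) = psums r u @ psums (r + sum_list u) z"
  by (induction u arbitrary: r) (simp_all add: add.assoc)

lemma lst_psums: "lst r (psums r z) = r + sum_list z"
  by (induction z arbitrary: r) (simp_all add: add.assoc)

lemma take_psums: "take i (psums r z) = psums r (take i z)"
  by (induction z arbitrary: r i) (simp_all add: take_Cons split: nat.split)

lemma drop_psums: "drop i (psums r z) = psums (r + sum_list (take i z)) (drop i z)"
  by (induction z arbitrary: r i) (simp_all add: drop_Cons take_Cons add.assoc split: nat.split)

lemma crl_psums: "crl r (psums (r + s) z) = crl 0 (psums s z)"
  for r s :: "'a::field"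
  by (induction z arbitrary: s) (simp_all add: add.assoc)

text \<open>In difference coordinates a grape does not depend on its root, so \<open>extend\<close>
  becomes a plain convolution. Translation invariance at \<open>t\<close> is assumed because its own
  induction uses this formula.\<close>

lemma vsum_Suc_psums_step:
  fixes r :: "'a::field"
  assumes "\<And>(r::'a) z. vsum t r (psums r z) = vsum t 0 (psums 0 z)"
  shows "vsum (Suc t) r (psums r z) =
    conv (\<lambda>u. crl 0 (psums 0 u)) (\<lambda>u. vsum t 0 (psums 0 u)) z"
  unfolding vsum.simps extend_def conv_def length_psums take_psums drop_psums lst_psums
  by (intro sum.cong refl arg_cong2[where f = times] assms crl_psums[of r 0, simplified])

lemma vsum_psums:
  fixes r :: "'a::field"
  shows "vsum t r (psums r z) = vsum t 0 (psums 0 z)"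
proof (induction t arbitrary: r z)
  case 0
  show ?case by (cases z) simp_all
next
  case (Suc t)
  show ?case
    unfolding vsum_Suc_psums_step[OF Suc] ..
qed

lemmas vsum_Suc_psums = vsum_Suc_psums_step[OF vsum_psums]

text \<open>The denominators of the shuffle equations in difference coordinates are sums of distinct
  letters; this keeps them nonzero.\<close>

definition zero_sum_free :: "'a::comm_monoid_add set \<Rightarrow> bool" where
  "zero_sum_free S \<longleftrightarrow> (\<forall>A\<subseteq>S. A \<noteq> {} \<longrightarrow> \<Sum>A \<noteq> 0)"

lemma zero_sum_free_mono: "zero_sum_free S \<Longrightarrow> T \<subseteq> S \<Longrightarrow> zero_sum_free T"
  by (auto simp: zero_sum_free_def)

lemma zero_sum_freeD: "zero_sum_free S \<Longrightarrow> distinct z \<Longrightarrow> z \<noteq> [] \<Longrightarrow> set z \<subseteq> S \<Longrightarrow> sum_list z \<noteq> 0"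
  using sum_list_distinct_conv_sum_set[of z "\<lambda>x. x"]
  by (auto simp: zero_sum_free_def)

lemma qsh_sum_list:
  "qsh 0 (\<lambda>z. sum_list z * \<Phi> z) v w = (sum_list v + sum_list w) * qsh 0 \<Phi> v w"
proof (induction "0::'a::field" \<Phi> v w rule: qsh.induct)
  case (3 \<Phi> a v b w)
  then show ?case
    by (simp add: distrib_right qsh_add qsh_scale) (simp add: algebra_simps)
qed simp_all

lemma qsh_single:
  "qsh 0 (\<lambda>z. if length z = 1 then 1 else 0) v w = (if length v + length w = 1 then 1 else 0)"
proof (cases "v = [] \<or> w = []")
  case False
  then obtain a v' b w' where "v = a # v'" "w = b # w'"
    by (metis neq_Nil_conv)
  then show ?thesis
    by (simp add: qsh_Nil_support)
qed auto

text \<open>The last factor of the grape is the reciprocal of the sum of all letters.\<close>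

lemma crl_psums_butlast:
  fixes z :: "'a::field list"
  assumes "sum_list z \<noteq> 0"
  shows "sum_list z * crl 0 (psums 0 z) = crl 0 (psums 0 (butlast z))"
  using assms by (cases z rule: rev_cases) (simp_all add: psums_append crl_append)

lemma conv_single:
  "conv M (\<lambda>z. if length z = 1 then 1 else 0) z = (if z = [] then 0 else M (butlast z))"
proof (cases z rule: rev_cases)
  case (snoc u x)
  have "conv M (\<lambda>z. if length z = 1 then 1 else 0) z = (\<Sum>i\<le>length z. if i = length u then M u else 0)"
    unfolding conv_def snoc by (intro sum.cong refl) auto
  then show ?thesis using snoc by simp
qed simp

text \<open>Convolution with the indicator of length \<open>1\<close> multiplies the grape in these coordinates by the sum of
  the letters, which is the same for every word of a shuffle.\<close>

lemma shuffle_crl_psums: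
  fixes v w :: "'a::field list"
  assumes "distinct (v @ w)" "zero_sum_free (set v \<union> set w)"
  shows "qsh 0 (\<lambda>z. crl 0 (psums 0 z)) v w = crl 0 (psums 0 v) * crl 0 (psums 0 w)"
  using assms
proof (induction "length v + length w" arbitrary: v w rule: less_induct)
  case less
  let ?g = "\<lambda>z. crl 0 (psums 0 z) :: 'a"
  let ?I = "\<lambda>z::'a list. if length z = 1 then 1 else 0 :: 'a"
  show ?case
  proof (cases "v = [] \<or> w = []")
    case False
    define p q where "p = length v - 1" and "q = length w - 1"
    have len: "length v = Suc p" "length w = Suc q"
      using False by (simp_all add: p_def q_def)
    have bl: "take p v = butlast v" "take q w = butlast w"
      by (simp_all add: p_def q_def butlast_conv_take)
    have sv: "sum_list v \<noteq> 0" and sw: "sum_list w \<noteq> 0" and svw: "sum_list v + sum_list w \<noteq> 0"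
      using zero_sum_freeD[OF less.prems(2), of v] zero_sum_freeD[OF less.prems(2), of w]
        zero_sum_freeD[OF less.prems(2), of "v @ w"] less.prems(1) False by auto
    have "(sum_list v + sum_list w) * qsh 0 ?g v w = qsh 0 (\<lambda>z. sum_list z * ?g z) v w"
      by (simp add: qsh_sum_list)
    also have "\<dots> = qsh 0 (conv ?g ?I) v w"
    proof (rule qsh_cong)
      fix z assume "distinct z" "set z \<subseteq> set v \<union> set w" "z = [] \<Longrightarrow> v = [] \<and> w = []"
      then show "sum_list z * ?g z = conv ?g ?I z"
        using zero_sum_freeD[OF less.prems(2), of z] False
        unfolding conv_single by (auto simp: crl_psums_butlast)
    qed (use less.prems in simp)
    \<comment> \<open>Only the cuts with a single letter on the right survive: the last letter of
      \<open>v\<close> or that of \<open>w\<close>.\<close>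
    also have "\<dots> = (\<Sum>i\<le>length v. \<Sum>j\<le>length w.
        (if i = p then if j = Suc q then qsh 0 ?g (butlast v) w else 0 else 0) +
        (if i = Suc p then if j = q then qsh 0 ?g v (butlast w) else 0 else 0))"
      unfolding qsh_conv qsh_single
      by (intro sum.cong refl) (auto simp: len bl)
    also have "\<dots> = qsh 0 ?g (butlast v) w + qsh 0 ?g v (butlast w)"
      unfolding sum.distrib len by (simp add: if_distrib[of "\<lambda>f. sum f _"] sum.delta cong: if_cong)
    also have "\<dots> = ?g (butlast v) * ?g w + ?g v * ?g (butlast w)"
    proof (intro arg_cong2[where f = "(+)"])
      show "qsh 0 ?g (butlast v) w = ?g (butlast v) * ?g w"
        using less.prems False
        by (intro less.hyps) (auto simp: distinct_butlast len dest: in_set_butlastD intro: zero_sum_free_mono)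
      show "qsh 0 ?g v (butlast w) = ?g v * ?g (butlast w)"
        using less.prems False
        by (intro less.hyps) (auto simp: distinct_butlast len dest: in_set_butlastD intro: zero_sum_free_mono)
    qed
    also have "\<dots> = (sum_list v + sum_list w) * (?g v * ?g w)"
      unfolding crl_psums_butlast[OF sv, symmetric] crl_psums_butlast[OF sw, symmetric]
      by (simp add: algebra_simps)
    finally show ?thesis
      using svw by simp
  qed auto
qed

text \<open>By \<open>qsh_conv\<close>, convolution preserves multiplicativity on shuffles, which
  \<open>shuffle_crl_psums\<close> provides for a single grape.\<close>

lemma shuffle_vsum_psums:
  fixes v w :: "'a::field list"
  assumes "distinct (v @ w)" "zero_sum_free (set v \<union> set w)"
  shows "qsh 0 (\<lambda>z. vsum t 0 (psums 0 z)) v w = vsum t 0 (psums 0 v) * vsum t 0 (psums 0 w)"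
  using assms
proof (induction t arbitrary: v w)
  case 0
  show ?case
  proof (cases "v = [] \<or> w = []")
    case False
    then have "qsh 0 (\<lambda>z. vsum 0 0 (psums 0 z)) v w = 0" "vsum 0 0 (psums 0 v) = 0"
      by (auto intro!: qsh_Nil_support simp: neq_Nil_conv)
    then show ?thesis by simp
  qed auto
next
  case (Suc t)
  show ?case
    unfolding vsum_Suc_psums qsh_conv
    unfolding conv_def sum_product
  proof (intro sum.cong refl)
    fix i j
    have d: "distinct (take i v @ take j w)" "distinct (drop i v @ drop j w)"
      using Suc.prems by (auto dest: in_set_takeD in_set_dropD)
    have z: "zero_sum_free (set (take i v) \<union> set (take j w))"
       "zero_sum_free (set (drop i v) \<union> set (drop j w))"
      using Suc.prems(2) set_take_subset[of i v] set_take_subset[of j w]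
        set_drop_subset[of i v] set_drop_subset[of j w]
      by (auto elim!: zero_sum_free_mono)
    show "qsh 0 (\<lambda>u. crl 0 (psums 0 u)) (take i v) (take j w) *
        qsh 0 (\<lambda>u. vsum t 0 (psums 0 u)) (drop i v) (drop j w) =
        crl 0 (psums 0 (take i v)) * vsum t 0 (psums 0 (drop i v)) *
        (crl 0 (psums 0 (take j w)) * vsum t 0 (psums 0 (drop j w)))"
      by (simp add: shuffle_crl_psums[OF d(1) z(1)] Suc.IH[OF d(2) z(2)])
  qed
qed

section \<open>The logarithm as a linear coefficient\<close>

lemma finite_vines [simp]: "finite (vines n)"
proof (rule finite_subset)
  have "length v \<le> sum_list v" if "\<forall>i\<in>set v. 1 \<le> i" for v :: "nat list"
    using that by (induction v) auto
  then show "vines n \<subseteq> {v. set v \<subseteq> {..n} \<and> length v \<le> n}"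
    by (auto simp: vines_def member_le_sum_list)
  show "finite {v. set v \<subseteq> {..n} \<and> length v \<le> n}"
    by (rule finite_lists_length_le) simp
qed

lemma length_vine: "v \<in> vines n \<Longrightarrow> length v \<le> n"
  unfolding vines_def by (auto, induction v arbitrary: n) auto

lemma Nil_in_vines: "[] \<in> vines n \<longleftrightarrow> n = 0"
  by (auto simp: vines_def)

lemma Cons_in_vines: "i # v \<in> vines n \<longleftrightarrow> 1 \<le> i \<and> i \<le> n \<and> v \<in> vines (n - i)"
  by (auto simp: vines_def)

lemma sum_vines_Cons:
  fixes f :: "nat list \<Rightarrow> 'a::comm_monoid_add"
  assumes "f [] = 0"
  shows "(\<Sum>v\<in>vines n. f v) = (\<Sum>i<n. \<Sum>v\<in>vines (n - Suc i). f (Suc i # v))"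
proof -
  have "(\<Sum>i<n. \<Sum>v\<in>vines (n - Suc i). f (Suc i # v)) =
      (\<Sum>(i, v)\<in>(SIGMA i:{..<n}. vines (n - Suc i)). f (Suc i # v))"
    by (rule sum.Sigma) simp_all
  also have "\<dots> = (\<Sum>v\<in>vines n - {[]}. f v)"
    by (rule sum.reindex_bij_witness[where i = "\<lambda>v. (hd v - 1, tl v)" and j = "\<lambda>(i, v). Suc i # v"])
      (auto simp: Cons_in_vines neq_Nil_conv)
  also have "\<dots> = (\<Sum>v\<in>vines n. f v)"
    by (rule sum.mono_neutral_left) (use assms in auto)
  finally show ?thesis ..
qed

text \<open>The reciprocal of \<open>x_v\<close> with root \<open>r\<close> and variables
  \<open>z\<close>; see \<open>vine_weight_prod\<close>.\<close>

primrec vine_weight :: "'a::field \<Rightarrow> 'a list \<Rightarrow> nat list \<Rightarrow> 'a" where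
  "vine_weight r z [] = 1"
| "vine_weight r z (i # v) = crl r (take i z) * vine_weight (lst r (take i z)) (drop i z) v"

text \<open>A vine of height \<open>k\<close> arises from \<open>t\<close> possibly empty grapes in
  \<open>t choose k\<close> ways, by the choice of the nonempty ones. The induction step is Pascal's
  rule.\<close>

lemma vsum_vines:
  "vsum t r z = (\<Sum>v\<in>vines (length z). of_nat (t choose length v) * vine_weight r z v)"
proof (induction t arbitrary: r z)
  case 0
  have "(\<Sum>v\<in>vines (length z). of_nat (0 choose length v) * vine_weight r z v) =
      (\<Sum>v\<in>vines (length z). if v = [] then 1 else 0)"
    by (intro sum.cong refl) (auto simp: neq_Nil_conv)
  then show ?case by (simp add: Nil_in_vines)
next
  case (Suc t)
  \<comment> \<open>The contribution in which the first of the \<open>t + 1\<close> grapes is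
    nonempty; an empty one leaves \<open>vsum t r z\<close>.\<close>
  define f where "f = (\<lambda>v. case v of [] \<Rightarrow> 0 | i # v' \<Rightarrow> of_nat (t choose length v') * vine_weight r z v)"
  have "vsum (Suc t) r z = vsum t r z +
     (\<Sum>i<length z. crl r (take (Suc i) z) * vsum t (lst r (take (Suc i) z)) (drop (Suc i) z))"
    by (simp add: extend_def sum.atMost_shift)
  also have "(\<Sum>i<length z. crl r (take (Suc i) z) * vsum t (lst r (take (Suc i) z)) (drop (Suc i) z)) =
      (\<Sum>i<length z. \<Sum>v\<in>vines (length z - Suc i). f (Suc i # v))"
    unfolding Suc by (intro sum.cong refl) (simp add: f_def sum_distrib_left mult_ac)
  also have "\<dots> = (\<Sum>v\<in>vines (length z). f v)"
    by (rule sum_vines_Cons[symmetric]) (simp add: f_def)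
  also have "vsum t r z + \<dots> = (\<Sum>v\<in>vines (length z). of_nat (t choose length v) * vine_weight r z v + f v)"
    unfolding Suc by (simp add: sum.distrib)
  also have "\<dots> = (\<Sum>v\<in>vines (length z). of_nat (Suc t choose length v) * vine_weight r z v)"
    by (intro sum.cong refl) (auto simp: f_def distrib_right split: list.split)
  finally show ?case .
qed

section \<open>Powers as polynomials in the exponent\<close>

definition binomial_poly :: "nat \<Rightarrow> 'a::field_char_0 poly" where
  "binomial_poly k = smult (1 / fact k) (\<Prod>i<k. [:- of_nat i, 1:])"

lemma poly_binomial_poly: "poly (binomial_poly k) (of_nat t) = of_nat (t choose k)"
  by (simp add: binomial_poly_def poly_prod binomial_gbinomial gbinomial_prod_rev lessThan_atLeast0)

lemma degree_binomial_poly: "degree (binomial_poly k) \<le> k"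
proof -
  have "degree (\<Prod>i<k. [:- of_nat i, 1:] :: 'a poly) \<le> (\<Sum>i<k. degree [:- of_nat i, 1 :: 'a:])"
    using degree_prod_sum_le[of "{..<k}" "\<lambda>i. [:- of_nat i, 1 :: 'a:]"] by (simp add: o_def)
  then show ?thesis
    by (simp add: binomial_poly_def)
qed

text \<open>The factor with \<open>i = 0\<close> is the variable itself, and the others contribute
  \<open>(-1)^k k!\<close> at zero. This produces the coefficients of the logarithm series.\<close>

lemma coeff_binomial_poly_1:
  "coeff (binomial_poly (Suc k)) (Suc 0) = (- 1) ^ (Suc k + 1) / of_nat (Suc k)"
proof -
  have "(\<Prod>i<Suc k. [:- of_nat i, 1:]) = [:0, 1:] * (\<Prod>i<k. [:- of_nat (Suc i), 1 :: 'a:])"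
    unfolding prod.lessThan_Suc_shift by simp
  moreover have "coeff (\<Prod>i<k. [:- of_nat (Suc i), 1 :: 'a:]) 0 = (- 1) ^ k * fact k"
    by (induction k) (simp_all add: coeff_mult algebra_simps)
  ultimately show ?thesis
    by (simp add: binomial_poly_def del: prod.lessThan_Suc)
qed

text \<open>The component of \<open>G^t\<close> at \<open>z\<close> as a polynomial in
  \<open>t\<close>.\<close>

definition vine_poly_sum :: "'a::field_char_0 list \<Rightarrow> 'a poly" where
  "vine_poly_sum z = (\<Sum>v\<in>vines (length z). smult (vine_weight 0 z v) (binomial_poly (length v)))"

lemma poly_vine_poly_sum: "poly (vine_poly_sum z) (of_nat t) = vsum t 0 z"
  by (simp add: vine_poly_sum_def vsum_vines poly_sum poly_binomial_poly mult.commute)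

lemma degree_vine_poly_sum: "degree (vine_poly_sum z) \<le> length z"
  unfolding vine_poly_sum_def
  by (intro degree_sum_le order_trans[OF degree_smult_le] order_trans[OF degree_binomial_poly] length_vine)
    simp_all

lemma coeff_vine_poly_sum_0: "z \<noteq> [] \<Longrightarrow> coeff (vine_poly_sum z) 0 = 0"
  using poly_vine_poly_sum[of z 0] by (simp add: poly_0_coeff_0)

lemma coeff_vine_poly_sum_1:
  assumes "z \<noteq> []"
  shows "coeff (vine_poly_sum z) (Suc 0) =
    (\<Sum>v\<in>vines (length z). (- 1) ^ (length v + 1) / of_nat (length v) * vine_weight 0 z v)"
  unfolding vine_poly_sum_def coeff_sum
proof (intro sum.cong refl)
  fix v assume "v \<in> vines (length z)"
  then obtain k where "length v = Suc k"
    using assms by (cases v) (auto simp: Nil_in_vines)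
  then show "coeff (smult (vine_weight 0 z v) (binomial_poly (length v))) (Suc 0) =
      (- 1) ^ (length v + 1) / of_nat (length v) * vine_weight 0 z v"
    by (simp only: coeff_smult coeff_binomial_poly_1 mult.commute)
qed

text \<open>Lagrange interpolation at \<open>0, ..., n\<close>. The weights \<open>\<mu>\<close>
  depend on \<open>n\<close> alone, so linear equations that hold for all natural powers pass to the
  linear coefficient.\<close>

lemma linear_coeff_by_values:
  "\<exists>\<mu>::nat \<Rightarrow> 'a::field_char_0. \<forall>p. degree p \<le> n \<longrightarrow> coeff p (Suc 0) = (\<Sum>j\<le>n. \<mu> j * poly p (of_nat j))"
proof -
  define l :: "nat \<Rightarrow> 'a poly" where
    "l = (\<lambda>j. \<Prod>i\<in>{..n} - {j}. smult (1 / (of_nat j - of_nat i)) [:- of_nat i, 1:])"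
  have deg: "degree (l j) \<le> n" if "j \<le> n" for j
  proof -
    have "degree (l j) \<le> (\<Sum>i\<in>{..n} - {j}. degree (smult (1 / (of_nat j - of_nat i)) [:- of_nat i, 1 :: 'a:]))"
      unfolding l_def using degree_prod_sum_le[of "{..n} - {j}" "\<lambda>i. smult (1 / (of_nat j - of_nat i)) [:- of_nat i, 1 :: 'a:]"]
      by (simp add: o_def)
    also have "\<dots> \<le> (\<Sum>i\<in>{..n} - {j}. 1)"
      by (intro sum_mono) simp
    finally show ?thesis using that by simp
  qed
  have val: "poly (l j) (of_nat i) = (if i = j then 1 else 0)" if "i \<le> n" for i j
  proof (cases "i = j")
    case True
    then show ?thesis unfolding l_def poly_prod by (auto intro!: prod.neutral simp: diff_divide_distrib[symmetric])
  next
    case False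
    then show ?thesis unfolding l_def poly_prod using that by (auto intro!: prod_zero)
  qed
  have "coeff p (Suc 0) = (\<Sum>j\<le>n. coeff (l j) (Suc 0) * poly p (of_nat j))" if p: "degree p \<le> n" for p
  proof -
    let ?L = "\<Sum>j\<le>n. smult (poly p (of_nat j)) (l j)"
    have "degree ?L \<le> n"
      by (intro degree_sum_le order_trans[OF degree_smult_le] deg) simp_all
    moreover have "card (of_nat ` {..n} :: 'a set) = Suc n"
      by (subst card_image) (simp_all add: inj_on_def)
    moreover have "poly p x = poly ?L x" if "x \<in> of_nat ` {..n}" for x
      using that by (auto simp: poly_sum val if_distrib cong: if_cong)
    ultimately have "p = ?L"
      using p by (intro poly_eqI_degree[where A = "of_nat ` {..n}"]) auto
    then have "coeff p (Suc 0) = coeff ?L (Suc 0)" by simp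
    then show ?thesis by (simp add: coeff_sum mult.commute)
  qed
  then show ?thesis
    by (intro exI[of _ "\<lambda>j. coeff (l j) (Suc 0)"] allI impI)
qed

text \<open>The element \<open>\<psi>\<^sub>-\<^sub>1\<close> as a function of field elements, by \<open>coeff_vine_poly_sum_1\<close>.\<close>

definition psi_val :: "'a::field_char_0 list \<Rightarrow> 'a" where
  "psi_val z = coeff (vine_poly_sum z) (Suc 0) / lst 0 z"

text \<open>All words of the stuffle have length at most \<open>n\<close>, so one choice of weights
  writes \<open>psi_val\<close> as a combination of the functions \<open>vlast j 0 0\<close>, whose
  stuffles vanish.\<close>

lemma stuffle_psi_val:
  fixes v w :: "'a::field_char_0 list"
  assumes "distinct (0 # v @ w)" "v \<noteq> []" "w \<noteq> []"
  shows "qsh 1 psi_val v w = 0"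
proof -
  define n where "n = length v + length w"
  obtain \<mu> :: "nat \<Rightarrow> 'a" where
    "\<forall>p. degree p \<le> n \<longrightarrow> coeff p (Suc 0) = (\<Sum>j\<le>n. \<mu> j * poly p (of_nat j))"
    using linear_coeff_by_values ..
  note \<mu> = this[rule_format]
  have "qsh 1 psi_val v w = qsh 1 (\<lambda>z. \<Sum>j\<le>n. \<mu> j * vlast j 0 0 z) v w"
  proof (rule qsh_cong)
    fix z :: "'a list" assume "length z \<le> length v + length w"
    then show "psi_val z = (\<Sum>j\<le>n. \<mu> j * vlast j 0 0 z)"
      using degree_vine_poly_sum[of z] unfolding psi_val_def
      by (subst \<mu>) (simp_all add: n_def vlast_def poly_vine_poly_sum sum_divide_distrib)
  qed (use assms in simp)
  also have "\<dots> = 0"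
    using assms by (simp add: qsh_sum qsh_scale stuffle_vlast)
  finally show ?thesis .
qed

lemma shuffle_psi_val:
  fixes v w :: "'a::field_char_0 list"
  assumes "distinct (v @ w)" "zero_sum_free (set v \<union> set w)" "v \<noteq> []" "w \<noteq> []"
  shows "qsh 0 (\<lambda>z. psi_val (psums 0 z)) v w = 0"
proof -
  \<comment> \<open>This bounds the degree for each word of the shuffle and also for the product of
    the polynomials of \<open>v\<close> and \<open>w\<close>, so the same weights serve on both
    sides.\<close>
  define n where "n = length v + length w"
  obtain \<mu> :: "nat \<Rightarrow> 'a" where
    "\<forall>p. degree p \<le> n \<longrightarrow> coeff p (Suc 0) = (\<Sum>j\<le>n. \<mu> j * poly p (of_nat j))"
    using linear_coeff_by_values ..
  note \<mu> = this[rule_format]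
  let ?P = "\<lambda>z. vine_poly_sum (psums 0 z)"
  \<comment> \<open>The sum of the letters, common to all words of the shuffle, cancels the
    denominator of \<open>psi_val\<close>.\<close>
  have "(sum_list v + sum_list w) * qsh 0 (\<lambda>z. psi_val (psums 0 z)) v w =
      qsh 0 (\<lambda>z. sum_list z * psi_val (psums 0 z)) v w"
    by (simp add: qsh_sum_list)
  also have "\<dots> = qsh 0 (\<lambda>z. \<Sum>j\<le>n. \<mu> j * vsum j 0 (psums 0 z)) v w"
  proof (rule qsh_cong)
    fix z assume z: "distinct z" "set z \<subseteq> set v \<union> set w" "length z \<le> length v + length w"
      "z = [] \<Longrightarrow> v = [] \<and> w = []"
    have "sum_list z \<noteq> 0"
      using zero_sum_freeD[OF assms(2), of z] z assms by auto
    then have "sum_list z * psi_val (psums 0 z) = coeff (?P z) (Suc 0)"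
      by (simp add: psi_val_def lst_psums)
    also have "\<dots> = (\<Sum>j\<le>n. \<mu> j * vsum j 0 (psums 0 z))"
      using degree_vine_poly_sum[of "psums 0 z"] z(3)
      by (subst \<mu>) (simp_all add: n_def poly_vine_poly_sum)
    finally show "sum_list z * psi_val (psums 0 z) = (\<Sum>j\<le>n. \<mu> j * vsum j 0 (psums 0 z))" .
  qed (use assms in simp)
  also have "\<dots> = (\<Sum>j\<le>n. \<mu> j * poly (?P v * ?P w) (of_nat j))"
    by (simp add: qsh_sum qsh_scale shuffle_vsum_psums[OF assms(1,2)] poly_vine_poly_sum)
  also have "\<dots> = coeff (?P v * ?P w) (Suc 0)"
  proof (rule \<mu>[symmetric])
    show "degree (?P v * ?P w) \<le> n"
      using degree_mult_le[of "?P v" "?P w"] degree_vine_poly_sum[of "psums 0 v"]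
        degree_vine_poly_sum[of "psums 0 w"] by (simp add: n_def)
  qed
  also have "\<dots> = 0"
  proof -
    have "psums 0 v \<noteq> []" "psums 0 w \<noteq> []"
      using assms(3,4) by (cases v; cases w; simp)+
    then show ?thesis
      by (simp add: coeff_mult coeff_vine_poly_sum_0)
  qed
  finally have "(sum_list v + sum_list w) * qsh 0 (\<lambda>z. psi_val (psums 0 z)) v w = 0" .
  moreover have "sum_list v + sum_list w \<noteq> 0"
    using zero_sum_freeD[OF assms(2), of "v @ w"] assms(1,3) by auto
  ultimately show ?thesis by simp
qed

section \<open>Rational functions\<close>

instance fract :: ("{idom, ring_char_0}") ring_char_0
proof
  show "inj (of_nat :: nat \<Rightarrow> 'a fract)"
    by (rule injI) (simp add: of_nat_fract eq_fract)
qed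

instance fract :: ("{idom, ring_char_0}") field_char_0 ..

lemma rf_const_uminus: "rf_const (- c) = - rf_const c"
  using rf_const_add[of "- c" c] by (simp add: eq_neg_iff_add_eq_0)

lemma rf_const_of_nat: "rf_const (of_nat n) = of_nat n"
  by (induction n) (simp_all add: rf_const_add)

lemma rf_const_power: "rf_const (c ^ n) = rf_const c ^ n"
  by (induction n) (simp_all add: rf_const_mult)

text \<open>The rules for \<open>O_comp\<close>, \<open>rf_homogeneous\<close> and
  \<open>rf_val\<close> know scalars only in the form \<open>rf_const\<close>.\<close>

lemma rf_const_vine_coeff:
  assumes "n > 0"
  shows "(- 1) ^ k / of_nat n = rf_const ((- 1) ^ k / of_nat n)"
proof -
  have "rf_const ((- 1) ^ k / of_nat n) * of_nat n = rf_const ((- 1) ^ k / of_nat n * of_nat n)"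
    by (simp only: rf_const_mult rf_const_of_nat)
  also have "\<dots> = (- 1) ^ k"
    using assms by (simp add: rf_const_power rf_const_uminus)
  finally show ?thesis
    using assms by (simp add: field_simps)
qed

definition monom1 :: "nat \<Rightarrow> ratpoly" where
  "monom1 i = Poly_Mapping.single (Poly_Mapping.single i 1) 1"

lemma X_monom1: "i \<noteq> 0 \<Longrightarrow> X i = Fract (monom1 i) 1"
  by (simp add: X_def monom1_def)

lemma X_0 [simp]: "X 0 = 0"
  by (simp add: X_def)

lemma lookup_monom1: "Poly_Mapping.lookup (monom1 i) (Poly_Mapping.single j 1) = (if i = j then 1 else 0)"
proof -
  have "Poly_Mapping.single i (1::nat) \<noteq> Poly_Mapping.single j 1" if "i \<noteq> j"
    using that by (metis lookup_single_eq lookup_single_not_eq one_neq_zero)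
  then show ?thesis
    by (auto simp: monom1_def lookup_single)
qed

lemma sum_X_Fract: "0 \<notin> I \<Longrightarrow> (\<Sum>i\<in>I. X i) = Fract (\<Sum>i\<in>I. monom1 i) 1"
  by (induction I rule: infinite_finite_induct) (auto simp: X_monom1 fract_collapse)

lemma sum_X_nonzero:
  assumes "finite I" "I \<noteq> {}" "0 \<notin> I"
  shows "(\<Sum>i\<in>I. X i) \<noteq> 0"
proof -
  obtain j where "j \<in> I" using assms by auto
  then have "Poly_Mapping.lookup (\<Sum>i\<in>I. monom1 i) (Poly_Mapping.single j 1) = 1"
    using assms(1) by (simp add: lookup_sum lookup_monom1[unfolded One_nat_def])
  then have "(\<Sum>i\<in>I. monom1 i) \<noteq> 0" by force
  then show ?thesis
    using assms(3) by (simp add: sum_X_Fract Zero_fract_def eq_fract)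
qed

lemma X_eq_iff [simp]: "X i = X j \<longleftrightarrow> i = j"
proof -
  have "X k \<noteq> 0" if "k \<noteq> 0" for k
    using sum_X_nonzero[of "{k}"] that by simp
  moreover have "i = j" if "i \<noteq> 0" "j \<noteq> 0" "X i = X j"
  proof -
    have "monom1 i = monom1 j"
      using that by (simp add: X_monom1 eq_fract)
    then show ?thesis
      using lookup_monom1[of i i] lookup_monom1[of j i] by (auto split: if_splits)
  qed
  ultimately show ?thesis
    by (metis X_0)
qed

lemma X_eq_0_iff [simp]: "X i = 0 \<longleftrightarrow> i = 0"
  using X_eq_iff[of i 0] by (simp del: X_eq_iff)

lemma inj_on_X: "inj_on X A"
  by (simp add: inj_on_def)

lemma zero_sum_free_X:
  assumes "finite I" "0 \<notin> I"
  shows "zero_sum_free (X ` I)"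
  unfolding zero_sum_free_def
proof (intro allI impI)
  fix A assume "A \<subseteq> X ` I" "A \<noteq> {}"
  then obtain J where J: "J \<subseteq> I" "A = X ` J" "J \<noteq> {}"
    by (auto simp: subset_image_iff)
  then show "\<Sum>A \<noteq> 0"
    using sum_X_nonzero[of J] assms by (auto simp: sum.reindex inj_on_X finite_subset)
qed

text \<open>The relational form of \<open>rf_subst\<close>: it also records that some representation
  has a nonvanishing denominator, and is therefore stable under the field operations.\<close>

definition rf_val :: "(nat \<Rightarrow> ratfun) \<Rightarrow> ratfun \<Rightarrow> ratfun \<Rightarrow> bool" where
  "rf_val \<sigma> f y \<longleftrightarrow>
     (\<exists>p q. q \<noteq> 0 \<and> f = Fract p q \<and> poly_eval \<sigma> q \<noteq> 0 \<and> y = poly_eval \<sigma> p / poly_eval \<sigma> q)"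

lemma rf_val_imp_subst: "rf_val \<sigma> f y \<Longrightarrow> rf_subst \<sigma> f = y"
  by (auto simp: rf_val_def rf_subst_Fract)

lemma poly_eval_1 [simp]: "poly_eval \<sigma> 1 = 1"
  using poly_eval_single[of \<sigma> 0 1] by simp

lemma rf_val_const: "rf_val \<sigma> (rf_const c) (rf_const c)"
proof -
  have "poly_eval \<sigma> (Poly_Mapping.single 0 c) = rf_const c"
    by (simp add: poly_eval_single)
  then show ?thesis
    unfolding rf_val_def
    by (intro exI[of _ "Poly_Mapping.single 0 c"] exI[of _ 1]) (simp add: rf_const_def)
qed

lemma rf_val_0: "rf_val \<sigma> 0 0" and rf_val_1: "rf_val \<sigma> 1 1"
  using rf_val_const[of \<sigma> 0] rf_val_const[of \<sigma> 1] by simp_all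

lemma rf_val_X:
  assumes "\<sigma> 0 = 0"
  shows "rf_val \<sigma> (X i) (\<sigma> i)"
proof (cases "i = 0")
  case False
  then show ?thesis
    unfolding rf_val_def
    by (intro exI[of _ "monom1 i"] exI[of _ 1]) (simp add: X_monom1, simp add: monom1_def poly_eval_single)
qed (simp add: assms rf_val_0)

lemma rf_val_add:
  assumes "rf_val \<sigma> f x" "rf_val \<sigma> g y"
  shows "rf_val \<sigma> (f + g) (x + y)"
proof -
  obtain p q p' q' where *: "q \<noteq> 0" "f = Fract p q" "poly_eval \<sigma> q \<noteq> 0" "x = poly_eval \<sigma> p / poly_eval \<sigma> q"
      "q' \<noteq> 0" "g = Fract p' q'" "poly_eval \<sigma> q' \<noteq> 0" "y = poly_eval \<sigma> p' / poly_eval \<sigma> q'"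
    using assms unfolding rf_val_def by blast
  then show ?thesis
    unfolding rf_val_def
    by (intro exI[of _ "p * q' + p' * q"] exI[of _ "q * q'"])
      (simp add: poly_eval_add poly_eval_mult add_frac_eq)
qed

lemma rf_val_mult:
  assumes "rf_val \<sigma> f x" "rf_val \<sigma> g y"
  shows "rf_val \<sigma> (f * g) (x * y)"
proof -
  obtain p q p' q' where *: "q \<noteq> 0" "f = Fract p q" "poly_eval \<sigma> q \<noteq> 0" "x = poly_eval \<sigma> p / poly_eval \<sigma> q"
      "q' \<noteq> 0" "g = Fract p' q'" "poly_eval \<sigma> q' \<noteq> 0" "y = poly_eval \<sigma> p' / poly_eval \<sigma> q'"
    using assms unfolding rf_val_def by blast
  then show ?thesis
    unfolding rf_val_def
    by (intro exI[of _ "p * p'"] exI[of _ "q * q'"]) (simp add: poly_eval_mult)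
qed

lemma rf_val_diff:
  assumes "rf_val \<sigma> f x" "rf_val \<sigma> g y"
  shows "rf_val \<sigma> (f - g) (x - y)"
  using rf_val_add[OF assms(1) rf_val_mult[OF rf_val_const[of \<sigma> "- 1"] assms(2)]]
  by (simp add: rf_const_uminus)

lemma rf_val_inverse:
  assumes "rf_val \<sigma> f x" "x \<noteq> 0"
  shows "rf_val \<sigma> (1 / f) (1 / x)"
proof -
  obtain p q where *: "q \<noteq> 0" "f = Fract p q" "poly_eval \<sigma> q \<noteq> 0" "x = poly_eval \<sigma> p / poly_eval \<sigma> q"
    using assms unfolding rf_val_def by blast
  moreover have "poly_eval \<sigma> p \<noteq> 0" "p \<noteq> 0"
    using assms(2) * by auto
  ultimately show ?thesis
    unfolding rf_val_def
    by (intro exI[of _ q] exI[of _ p]) (simp add: divide_inverse)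
qed

lemma rf_val_sum: "(\<And>i. i \<in> I \<Longrightarrow> rf_val \<sigma> (f i) (g i)) \<Longrightarrow> rf_val \<sigma> (\<Sum>i\<in>I. f i) (\<Sum>i\<in>I. g i)"
  by (induction I rule: infinite_finite_induct) (auto intro: rf_val_add rf_val_0)

lemma rf_val_prod: "(\<And>i. i \<in> I \<Longrightarrow> rf_val \<sigma> (f i) (g i)) \<Longrightarrow> rf_val \<sigma> (\<Prod>i\<in>I. f i) (\<Prod>i\<in>I. g i)"
  by (induction I rule: infinite_finite_induct) (auto intro: rf_val_mult rf_val_1)

section \<open>Homogeneity of rational functions\<close>

lemma poly_homogeneous_mult:
  assumes "poly_homogeneous a p" "poly_homogeneous b q"
  shows "poly_homogeneous (a + b) (p * q)"
  unfolding poly_homogeneous_def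
proof
  fix m assume "m \<in> Poly_Mapping.keys (p * q)"
  then obtain k l where kl: "m = k + l" "k \<in> Poly_Mapping.keys p" "l \<in> Poly_Mapping.keys q"
    using keys_mult[of p q] by auto
  let ?A = "Poly_Mapping.keys k \<union> Poly_Mapping.keys l"
  have deg: "(\<Sum>i\<in>Poly_Mapping.keys n. Poly_Mapping.lookup n i) = (\<Sum>i\<in>?A. Poly_Mapping.lookup n i)"
    if "Poly_Mapping.keys n \<subseteq> ?A" for n :: "nat \<Rightarrow>\<^sub>0 nat"
    using that by (intro sum.mono_neutral_left) (auto simp: in_keys_iff)
  have "(\<Sum>i\<in>Poly_Mapping.keys m. Poly_Mapping.lookup m i) =
      (\<Sum>i\<in>?A. Poly_Mapping.lookup k i) + (\<Sum>i\<in>?A. Poly_Mapping.lookup l i)"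
    unfolding kl(1) deg[OF keys_add] by (simp add: lookup_add sum.distrib)
  also have "\<dots> = a + b"
    using assms kl(2,3) deg[of k] deg[of l] unfolding poly_homogeneous_def by auto
  finally show "(\<Sum>i\<in>Poly_Mapping.keys m. Poly_Mapping.lookup m i) = a + b" .
qed

lemma poly_homogeneous_add:
  "poly_homogeneous a p \<Longrightarrow> poly_homogeneous a q \<Longrightarrow> poly_homogeneous a (p + q)"
  using keys_add[of p q] by (auto simp: poly_homogeneous_def)

lemma poly_homogeneous_const: "poly_homogeneous 0 (Poly_Mapping.single 0 c)"
  by (simp add: poly_homogeneous_def)

lemma rf_homogeneous_const: "rf_homogeneous 0 (rf_const c)"
proof -
  have "rf_const c = Fract (Poly_Mapping.single 0 c) (Poly_Mapping.single 0 1)"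
    by (simp add: rf_const_def)
  then show ?thesis
    unfolding rf_homogeneous_def
    by (intro exI[of _ "Poly_Mapping.single 0 c"] exI[of _ "Poly_Mapping.single 0 1"] exI[of _ 0])
      (simp add: poly_homogeneous_const del: single_one, simp)
qed

lemma rf_homogeneous_X:
  assumes "i \<noteq> 0"
  shows "rf_homogeneous 1 (X i)"
proof -
  have "poly_homogeneous 1 (monom1 i)"
    by (simp add: monom1_def poly_homogeneous_def)
  moreover have "poly_homogeneous 0 1"
    using poly_homogeneous_const[of 1] by simp
  ultimately show ?thesis
    unfolding rf_homogeneous_def
    using X_monom1[OF assms]
    by (intro exI[of _ "monom1 i"] exI[of _ 1] exI[of _ "1::nat"] exI[of _ "0::nat"]) simp
qed

lemma rf_homogeneous_add:
  assumes "rf_homogeneous n f" "rf_homogeneous n g"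
  shows "rf_homogeneous n (f + g)"
proof -
  obtain p q a b p' q' a' b' where
    *: "q \<noteq> 0" "f = Fract p q" "poly_homogeneous a p" "poly_homogeneous b q" "n = int a - int b"
       "q' \<noteq> 0" "g = Fract p' q'" "poly_homogeneous a' p'" "poly_homogeneous b' q'" "n = int a' - int b'"
    using assms unfolding rf_homogeneous_def by blast
  \<comment> \<open>Equal differences of degrees make the two cross products homogeneous of the same
    degree.\<close>
  have "a' + b = a + b'"
    using *(5,10) by linarith
  then have "poly_homogeneous (a + b') (p * q' + p' * q)"
    using poly_homogeneous_mult[OF *(3,9)] poly_homogeneous_mult[OF *(8,4)]
    by (intro poly_homogeneous_add) simp_all
  then show ?thesis
    unfolding rf_homogeneous_def using * poly_homogeneous_mult[OF *(4,9)]
    by (intro exI[of _ "p * q' + p' * q"] exI[of _ "q * q'"] exI[of _ "a + b'"] exI[of _ "b + b'"]) simp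
qed

lemma rf_homogeneous_mult:
  assumes "rf_homogeneous n f" "rf_homogeneous m g"
  shows "rf_homogeneous (n + m) (f * g)"
proof -
  obtain p q a b p' q' a' b' where
    *: "q \<noteq> 0" "f = Fract p q" "poly_homogeneous a p" "poly_homogeneous b q" "n = int a - int b"
       "q' \<noteq> 0" "g = Fract p' q'" "poly_homogeneous a' p'" "poly_homogeneous b' q'" "m = int a' - int b'"
    using assms unfolding rf_homogeneous_def by blast
  then show ?thesis
    unfolding rf_homogeneous_def using poly_homogeneous_mult[OF *(4,9)] poly_homogeneous_mult[OF *(3,8)]
    by (intro exI[of _ "p * p'"] exI[of _ "q * q'"] exI[of _ "a + a'"] exI[of _ "b + b'"]) simp
qed

lemma rf_homogeneous_diff:
  assumes "rf_homogeneous n f" "rf_homogeneous n g"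
  shows "rf_homogeneous n (f - g)"
  using rf_homogeneous_add[OF assms(1) rf_homogeneous_mult[OF rf_homogeneous_const[of "- 1"] assms(2), simplified]]
  by (simp add: rf_const_uminus)

lemma rf_homogeneous_inverse:
  assumes "rf_homogeneous n f" "f \<noteq> 0"
  shows "rf_homogeneous (- n) (1 / f)"
proof -
  obtain p q a b where
    *: "q \<noteq> 0" "f = Fract p q" "poly_homogeneous a p" "poly_homogeneous b q" "n = int a - int b"
    using assms unfolding rf_homogeneous_def by blast
  moreover have "p \<noteq> 0"
    using assms(2) * by (auto simp: fract_collapse)
  ultimately show ?thesis
    unfolding rf_homogeneous_def
    by (intro exI[of _ q] exI[of _ p] exI[of _ b] exI[of _ a]) (simp add: divide_inverse)
qed

lemma rf_homogeneous_sum: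
  assumes "I \<noteq> {}" "finite I" "\<And>i. i \<in> I \<Longrightarrow> rf_homogeneous n (f i)"
  shows "rf_homogeneous n (\<Sum>i\<in>I. f i)"
  using assms(2,1,3) by (induction I rule: finite_ne_induct) (auto intro: rf_homogeneous_add)

lemma rf_homogeneous_prod:
  assumes "\<And>i. i \<in> I \<Longrightarrow> rf_homogeneous (d i) (f i)"
  shows "rf_homogeneous (\<Sum>i\<in>I. d i) (\<Prod>i\<in>I. f i)"
  using assms rf_homogeneous_const[of 1]
  by (induction I rule: infinite_finite_induct) (auto intro: rf_homogeneous_mult)

section \<open>Membership in the rings of components\<close>

lemma O_comp_sum: "(\<And>i. i \<in> I \<Longrightarrow> f i \<in> O_comp d) \<Longrightarrow> (\<Sum>i\<in>I. f i) \<in> O_comp d"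
  using O_comp.const[of 0 d]
  by (induction I rule: infinite_finite_induct) (auto intro: O_comp.add)

lemma O_comp_prod: "(\<And>i. i \<in> I \<Longrightarrow> f i \<in> O_comp d) \<Longrightarrow> (\<Prod>i\<in>I. f i) \<in> O_comp d"
  using O_comp.const[of 1 d]
  by (induction I rule: infinite_finite_induct) (auto intro: O_comp.mult)

text \<open>The factors of a vine are the negatives of the generating differences, or single
  variables if the root \<open>x_0 = 0\<close> is involved.\<close>

lemma O_comp_inverse_diff:
  assumes "i < j" "j \<le> d"
  shows "inverse (X j - X i) \<in> O_comp d"
proof (cases "i = 0")
  case True
  then show ?thesis using assms O_comp.inverse_var[of j d] by simp
next
  case False
  then have "rf_const (- 1) * inverse (X i - X j) \<in> O_comp d"
    using assms by (intro O_comp.mult O_comp.const O_comp.inverse_diff) simp_all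
  also have "rf_const (- 1) * inverse (X i - X j) = inverse (X j - X i)"
    by (metis inverse_minus_eq minus_diff_eq mult_minus1 rf_const_1 rf_const_uminus)
  finally show ?thesis .
qed

section \<open>The element \<open>\<psi>\<^sub>-\<^sub>1\<close>\<close>

lemma vine_S_Cons: "vine_S (i # v) (Suc j) = i + vine_S v j"
  by (simp add: vine_S_def)

lemma vine_S_add:
  assumes "1 \<le> j" "j \<le> length v"
  shows "vine_S v (j - 1) + v ! (j - 1) = vine_S v j"
proof -
  obtain k where "j = Suc k" using assms by (cases j) auto
  with assms show ?thesis
    by (simp add: vine_S_def take_Suc_conv_app_nth)
qed

lemma vine_S_le: "vine_S v j \<le> sum_list v"
proof -
  have "sum_list v = sum_list (take j v) + sum_list (drop j v)"
    by (simp flip: sum_list_append)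
  then show ?thesis by (simp add: vine_S_def)
qed

lemma vine_index_le:
  assumes "v \<in> vines d" "j \<in> {1..length v}" "m \<in> {1..v ! (j - 1)}"
  shows "vine_S v (j - 1) + m \<le> d"
  using assms vine_S_add[of j v] vine_S_le[of v j] by (auto simp: vines_def)

lemma sum_vine_heights: "(\<Sum>j=1..length v. v ! (j - 1)) = sum_list v"
  by (simp add: sum.atLeast1_atMost_eq sum_list_sum_nth lessThan_atLeast0)

lemma vine_poly_nonzero: "vine_poly v \<noteq> 0"
  by (simp add: vine_poly_def)

lemma vine_poly_homogeneous:
  assumes "v \<in> vines d"
  shows "rf_homogeneous (int d) (vine_poly v)"
proof -
  have "rf_homogeneous (\<Sum>j=1..length v. \<Sum>m=1..v ! (j - 1). 1) (vine_poly v)"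
    unfolding vine_poly_def
  proof (intro rf_homogeneous_prod)
    fix j m assume "m \<in> {1..v ! (j - 1)}"
    then show "rf_homogeneous 1 (X (vine_S v (j - 1) + m) - X (vine_S v (j - 1)))"
      by (cases "vine_S v (j - 1) = 0") (auto intro: rf_homogeneous_diff rf_homogeneous_X)
  qed
  moreover have "(\<Sum>j=1..length v. \<Sum>m=1..v ! (j - 1). 1) = int d"
    using assms sum_vine_heights[of v] by (simp add: vines_def flip: of_nat_sum)
  ultimately show ?thesis by simp
qed

lemma psi_m1_summand_const:
  assumes "v \<in> vines d" "1 \<le> d"
  shows "(- 1) ^ (length v + 1) / of_nat (length v) = rf_const ((- 1) ^ (length v + 1) / of_nat (length v))"
proof -
  have "v \<noteq> []" using assms by (auto simp: vines_def)
  then show ?thesis by (intro rf_const_vine_coeff) simp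
qed

lemma psi_m1_homogeneous: "homogeneous_of_weight (- 1) psi_m1"
  unfolding homogeneous_of_weight_def
proof (intro allI impI)
  fix d :: nat assume d: "1 \<le> d"
  have "vines d \<noteq> {}"
    using d by (auto simp: vines_def intro!: exI[of _ "[d]"])
  then show "rf_homogeneous (- 1 - int d) (psi_m1 d)"
    unfolding psi_m1_def
  proof (rule rf_homogeneous_sum)
    fix v assume v: "v \<in> vines d"
    have "rf_homogeneous (int d + 1) (vine_poly v * X d)"
      using d by (intro rf_homogeneous_mult vine_poly_homogeneous v rf_homogeneous_X) simp
    then have "rf_homogeneous (- (int d + 1)) (1 / (vine_poly v * X d))"
      using d by (intro rf_homogeneous_inverse) (simp_all add: vine_poly_nonzero)
    then have "rf_homogeneous (0 + - (int d + 1))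
        (rf_const ((- 1) ^ (length v + 1) / of_nat (length v)) * (1 / (vine_poly v * X d)))"
      by (intro rf_homogeneous_mult rf_homogeneous_const)
    moreover have "0 + - (int d + 1) = - 1 - int d"
      by simp
    ultimately show "rf_homogeneous (- 1 - int d)
        ((- 1) ^ (length v + 1) / of_nat (length v) * (1 / (vine_poly v * X d)))"
      by (simp only: psi_m1_summand_const[OF v d, symmetric])
  qed simp
qed

lemma psi_m1_O_ring: "psi_m1 \<in> O_ring"
  unfolding O_ring_def
proof (intro CollectI allI impI)
  fix d :: nat assume d: "1 \<le> d"
  show "psi_m1 d \<in> O_comp d"
    unfolding psi_m1_def
  proof (rule O_comp_sum)
    fix v assume v: "v \<in> vines d"
    have "1 / (vine_poly v * X d) = inverse (vine_poly v) * inverse (X d)"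
      by (simp add: divide_inverse)
    also have "inverse (vine_poly v) = (\<Prod>j=1..length v. \<Prod>m=1..v ! (j - 1).
        inverse (X (vine_S v (j - 1) + m) - X (vine_S v (j - 1))))"
      unfolding vine_poly_def by (simp only: prod_inversef[symmetric] o_def)
    finally have "1 / (vine_poly v * X d) = \<dots> * inverse (X d)" .
    moreover have "\<dots> \<in> O_comp d"
      using d by (intro O_comp.mult O_comp_prod O_comp.inverse_var O_comp_inverse_diff vine_index_le[OF v]) auto
    ultimately show "(- 1) ^ (length v + 1) / of_nat (length v) * (1 / (vine_poly v * X d)) \<in> O_comp d"
      unfolding psi_m1_summand_const[OF v d] by (intro O_comp.mult O_comp.const) simp
  qed
qed

text \<open>Positions in \<open>r # z\<close> are the indices of the vertices, the root being vertex
  0; removing the first grape shifts them by \<open>i\<close>.\<close>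

lemma nth_lst_drop:
  assumes "i \<le> length z"
  shows "(lst r (take i z) # drop i z) ! k = (r # z) ! (i + k)"
proof (cases k)
  case 0
  then show ?thesis
    using assms by (cases i) (simp_all add: lst_take_Suc)
next
  case (Suc k')
  then show ?thesis using assms by simp
qed

lemma crl_take_prod:
  assumes "i \<le> length z"
  shows "crl r (take i z) = 1 / (\<Prod>m=1..i. (r # z) ! m - r)"
  using assms
proof (induction i)
  case (Suc i)
  then show ?case
    by (simp add: crl_take_Suc)
qed simp

text \<open>The shifts by the successive grape sizes accumulate to the partial sums
  \<open>vine_S\<close>.\<close>

lemma vine_weight_prod:
  assumes "sum_list v \<le> length z"
  shows "vine_weight r z v = 1 / (\<Prod>j=1..length v. \<Prod>m=1..v ! (j - 1).
           (r # z) ! (vine_S v (j - 1) + m) - (r # z) ! vine_S v (j - 1))"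
  using assms
proof (induction v arbitrary: r z)
  case (Cons i v)
  let ?r = "lst r (take i z)" and ?z = "drop i z"
  have i: "i \<le> length z" using Cons.prems by simp
  have "vine_weight ?r ?z v = 1 / (\<Prod>j=1..length v. \<Prod>m=1..v ! (j - 1).
           (?r # ?z) ! (vine_S v (j - 1) + m) - (?r # ?z) ! vine_S v (j - 1))"
    using Cons.prems by (intro Cons.IH) simp
  also have "(\<Prod>j=1..length v. \<Prod>m=1..v ! (j - 1).
           (?r # ?z) ! (vine_S v (j - 1) + m) - (?r # ?z) ! vine_S v (j - 1)) =
      (\<Prod>j<length v. \<Prod>m=1..v ! j.
           (r # z) ! (vine_S (i # v) (Suc j) + m) - (r # z) ! vine_S (i # v) (Suc j))"
    unfolding nth_lst_drop[OF i] vine_S_Cons by (simp add: prod.atLeast1_atMost_eq add.assoc)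
  finally have "vine_weight r z (i # v) = 1 / ((\<Prod>m=1..i. (r # z) ! m - r) *
      (\<Prod>j<length v. \<Prod>m=1..v ! j.
           (r # z) ! (vine_S (i # v) (Suc j) + m) - (r # z) ! vine_S (i # v) (Suc j)))"
    by (simp add: crl_take_prod[OF i])
  also have "\<dots> = 1 / (\<Prod>j<length (i # v). \<Prod>m=1..(i # v) ! j.
       (r # z) ! (vine_S (i # v) j + m) - (r # z) ! vine_S (i # v) j)"
    unfolding length_Cons prod.lessThan_Suc_shift by (simp add: vine_S_def)
  also have "(\<Prod>j<length (i # v). \<Prod>m=1..(i # v) ! j.
       (r # z) ! (vine_S (i # v) j + m) - (r # z) ! vine_S (i # v) j) =
      (\<Prod>j=1..length (i # v). \<Prod>m=1..(i # v) ! (j - 1).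
       (r # z) ! (vine_S (i # v) (j - 1) + m) - (r # z) ! vine_S (i # v) (j - 1))"
    by (simp only: One_nat_def prod.atLeast1_atMost_eq diff_Suc_Suc diff_zero)
  finally show ?case .
qed simp

text \<open>Every factor of \<open>x_v\<close> evaluates to a difference of two different entries of
  \<open>0 # z\<close>, and \<open>x_d\<close> to the nonzero last one, so the substitution meets no
  vanishing denominator.\<close>

lemma rf_app_psi_m1:
  assumes "distinct (0 # z)" "z \<noteq> []"
  shows "rf_app (psi_m1 (length z)) z = psi_val z"
proof -
  let ?n = "length z"
  define \<sigma> where "\<sigma> = (\<lambda>i. if 1 \<le> i \<and> i \<le> ?n then z ! (i - 1) else 0)"
  have \<sigma>: "\<sigma> i = (0 # z) ! i" if "i \<le> ?n" for i
    using that by (cases i) (auto simp: \<sigma>_def)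
  have val: "rf_val \<sigma> (X i) (\<sigma> i)" for i
    by (rule rf_val_X) (simp add: \<sigma>_def)
  have \<sigma>_neq: "\<sigma> i \<noteq> \<sigma> j" if "i \<noteq> j" "i \<le> ?n" "j \<le> ?n" for i j
    using that nth_eq_iff_index_eq[OF assms(1), of i j] by (simp add: \<sigma>)
  have last: "\<sigma> ?n = lst 0 z"
    using nth_lst_drop[of ?n z 0 0] by (simp add: \<sigma>)
  have last0: "lst 0 z \<noteq> 0"
    using \<sigma>_neq[of ?n 0] assms(2) by (simp add: last) (simp add: \<sigma>_def)
  have term_val: "rf_val \<sigma> (1 / (vine_poly v * X ?n)) (vine_weight 0 z v / lst 0 z)" if v: "v \<in> vines ?n" for v
  proof -
    let ?Q = "\<Prod>j=1..length v. \<Prod>m=1..v ! (j - 1). \<sigma> (vine_S v (j - 1) + m) - \<sigma> (vine_S v (j - 1))"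
    have "rf_val \<sigma> (vine_poly v * X ?n) (?Q * \<sigma> ?n)"
      unfolding vine_poly_def by (intro rf_val_mult rf_val_prod rf_val_diff val)
    moreover have "?Q \<noteq> 0"
    proof -
      have "\<sigma> (vine_S v (j - 1) + m) - \<sigma> (vine_S v (j - 1)) \<noteq> 0"
        if "j \<in> {1..length v}" "m \<in> {1..v ! (j - 1)}" for j m
        using vine_index_le[OF v that] that \<sigma>_neq[of "vine_S v (j - 1) + m" "vine_S v (j - 1)"] by simp
      then show ?thesis by simp
    qed
    ultimately have "rf_val \<sigma> (1 / (vine_poly v * X ?n)) (1 / (?Q * \<sigma> ?n))"
      using last0 by (intro rf_val_inverse) (simp_all add: last)
    also have "?Q = (\<Prod>j=1..length v. \<Prod>m=1..v ! (j - 1).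
        (0 # z) ! (vine_S v (j - 1) + m) - (0 # z) ! vine_S v (j - 1))"
    proof (intro prod.cong refl)
      fix j m assume "j \<in> {1..length v}" "m \<in> {1..v ! (j - 1)}"
      from vine_index_le[OF v this]
      show "\<sigma> (vine_S v (j - 1) + m) - \<sigma> (vine_S v (j - 1)) =
          (0 # z) ! (vine_S v (j - 1) + m) - (0 # z) ! vine_S v (j - 1)"
        by (simp only: \<sigma> add_leD1)
    qed
    also have "1 / (\<dots> * \<sigma> ?n) = vine_weight 0 z v / lst 0 z"
      using v by (subst vine_weight_prod) (simp_all add: vines_def last)
    finally show ?thesis .
  qed
  have "rf_val \<sigma> (psi_m1 ?n) (\<Sum>v\<in>vines ?n. (- 1) ^ (length v + 1) / of_nat (length v) * (vine_weight 0 z v / lst 0 z))"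
    unfolding psi_m1_def
  proof (rule rf_val_sum)
    fix v assume v: "v \<in> vines ?n"
    have n: "1 \<le> ?n" using assms(2) by (cases z) auto
    show "rf_val \<sigma> ((- 1) ^ (length v + 1) / of_nat (length v) * (1 / (vine_poly v * X ?n)))
       ((- 1) ^ (length v + 1) / of_nat (length v) * (vine_weight 0 z v / lst 0 z))"
      unfolding psi_m1_summand_const[OF v n] by (intro rf_val_mult rf_val_const term_val v)
  qed
  also have "(\<Sum>v\<in>vines ?n. (- 1) ^ (length v + 1) / of_nat (length v) * (vine_weight 0 z v / lst 0 z)) = psi_val z"
    unfolding psi_val_def coeff_vine_poly_sum_1[OF assms(2)] sum_divide_distrib by simp
  finally show ?thesis
    unfolding rf_app_def \<sigma>_def[symmetric] by (rule rf_val_imp_subst)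
qed

section \<open>Translation of the double shuffle equations\<close>

lemma stuffle_F_qsh:
  "stuffle_F f u v w =
     qsh 1 (\<lambda>z. rf_app (f (length u + length z)) (map X u @ z)) (map X v) (map X w)"
  by (induction f u v w rule: stuffle_F.induct) (simp_all add: add.assoc)

lemma psi_m1_stuffle: "stuffle_mod_products psi_m1"
  unfolding stuffle_mod_products_def
proof (intro allI impI)
  fix p q :: nat assume pq: "1 \<le> p" "1 \<le> q"
  let ?v = "map X [1..<p + 1]" and ?w = "map X [p + 1..<p + q + 1]"
  have dist: "distinct (0 # ?v @ ?w)"
    by (auto simp: distinct_map inj_on_X)
  have "stuffle_F psi_m1 [] [1..<p + 1] [p + 1..<p + q + 1] = qsh 1 (\<lambda>z. rf_app (psi_m1 (length z)) z) ?v ?w"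
    by (simp add: stuffle_F_qsh del: upt_Suc)
  also have "\<dots> = qsh 1 psi_val ?v ?w"
  proof (rule qsh_cong)
    fix z assume "distinct z" "set z \<subseteq> set ?v \<union> set ?w" "z = [] \<Longrightarrow> ?v = [] \<and> ?w = []"
    with dist pq show "rf_app (psi_m1 (length z)) z = psi_val z"
      by (intro rf_app_psi_m1) auto
  qed (use dist in simp)
  also have "\<dots> = 0"
    by (rule stuffle_psi_val[OF dist]) (use pq in auto)
  finally show "stuffle_F psi_m1 [] [1..<p + 1] [p + 1..<p + q + 1] = 0" .
qed

text \<open>Distinct letters make the shuffles starting with \<open>x\<close> and those starting
  with \<open>y\<close> disjoint, so the sum over the set follows the recursion of
  \<open>qsh\<close> without loss of multiplicity.\<close>

lemma sum_shuffles_qsh: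
  assumes "distinct (v @ w)"
  shows "(\<Sum>z\<in>shuffles v w. \<Phi> (map g z)) = qsh 0 \<Phi> (map g v) (map g w)"
  using assms
proof (induction v w arbitrary: \<Phi> rule: shuffles.induct)
  case (3 x xs y ys)
  have "(\<Sum>z\<in>shuffles (x # xs) (y # ys). \<Phi> (map g z)) =
     (\<Sum>z\<in>(#) x ` shuffles xs (y # ys). \<Phi> (map g z)) + (\<Sum>z\<in>(#) y ` shuffles (x # xs) ys. \<Phi> (map g z))"
    unfolding shuffles.simps by (rule sum.union_disjoint) (use 3 in auto)
  also have "\<dots> = (\<Sum>z\<in>shuffles xs (y # ys). \<Phi> (g x # map g z)) + (\<Sum>z\<in>shuffles (x # xs) ys. \<Phi> (g y # map g z))"
    by (simp add: sum.reindex)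
  finally show ?case
    using 3(1)[of "\<lambda>z. \<Phi> (g x # z)"] 3(2)[of "\<lambda>z. \<Phi> (g y # z)"] 3(3) by simp
qed simp_all

text \<open>Filtering by \<open>i <= p\<close> recovers the two interleaved words, and every word is
  a shuffle of its two filtered parts.\<close>

lemma Sh_eq_shuffles: "Sh p q = shuffles [1..<p + 1] [p + 1..<p + q + 1]"
proof (intro equalityI subsetI)
  fix w assume w: "w \<in> Sh p q"
  have "filter (\<lambda>i. i \<le> p) w = [1..<p + 1]"
    using w by (intro sorted_distinct_set_unique) (auto simp: Sh_def simp del: upt_Suc)
  moreover have "filter (\<lambda>i. \<not> i \<le> p) w = [p + 1..<p + q + 1]"
    using w by (intro sorted_distinct_set_unique) (auto simp: Sh_def not_le simp del: upt_Suc)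
  ultimately show "w \<in> shuffles [1..<p + 1] [p + 1..<p + q + 1]"
    using partition_in_shuffles[of w "\<lambda>i. i \<le> p"] by simp
next
  fix w assume w: "w \<in> shuffles [1..<p + 1] [p + 1..<p + q + 1]"
  have disj: "set [1..<p + 1] \<inter> set [p + 1..<p + q + 1] = {}"
    by auto
  have s: "set w = {1..p + q}"
    unfolding set_shuffles[OF w] by auto
  have "filter (\<lambda>i. i \<le> p) w = filter (\<lambda>i. i \<in> set [1..<p + 1]) w"
    by (intro filter_cong refl) (auto simp: s simp del: upt_Suc)
  also have "\<dots> = [1..<p + 1]"
    by (rule filter_shuffles_disjoint1(1)[OF disj w])
  finally have "sorted (filter (\<lambda>i. i \<le> p) w)"
    by (simp del: upt_Suc)
  moreover have "filter (\<lambda>i. p < i) w = filter (\<lambda>i. i \<in> set [p + 1..<p + q + 1]) w"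
    by (intro filter_cong refl) (auto simp: s simp del: upt_Suc)
  then have "filter (\<lambda>i. p < i) w = [p + 1..<p + q + 1]"
    by (simp only: filter_shuffles_disjoint2(1)[OF disj w])
  then have "sorted (filter (\<lambda>i. p < i) w)"
    by (simp del: upt_Suc)
  moreover have "distinct w"
    using distinct_disjoint_shuffles[OF _ _ disj w] by simp
  ultimately show "w \<in> Sh p q"
    using s by (simp add: Sh_def)
qed

lemma nth_psums: "i < length z \<Longrightarrow> psums r z ! i = r + sum_list (take (Suc i) z)"
  for r :: "'a::monoid_add"
  by (induction z arbitrary: r i) (auto simp: nth_Cons add.assoc split: nat.split)

text \<open>Two partial sums differ by a sum of consecutive letters, which is nonzero.\<close>

lemma distinct_psums:
  fixes r :: "'a::ab_group_add"
  assumes "distinct z" "zero_sum_free (set z)"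
  shows "distinct (r # psums r z)"
  using assms
proof (induction z arbitrary: r)
  case (Cons y z)
  have "r \<noteq> psums r (y # z) ! i" if "i < length (y # z)" for i
  proof -
    have "sum_list (take (Suc i) (y # z)) \<noteq> 0"
      using Cons.prems that
      by (intro zero_sum_freeD[OF Cons.prems(2)]) (auto dest: in_set_takeD intro: distinct_take)
    then show ?thesis
      unfolding nth_psums[OF that] by simp
  qed
  then have "r \<notin> set (psums r (y # z))"
    by (metis in_set_conv_nth length_psums)
  moreover have "distinct ((r + y) # psums (r + y) z)"
    using Cons.prems by (intro Cons.IH) (auto intro: zero_sum_free_mono)
  ultimately show ?case by simp
qed simp

lemma map_partial_sums: "map (\<lambda>k. \<Sum>i<k. X (w ! i)) [1..<length w + 1] = psums 0 (map X w)"
  by (rule nth_equalityI)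
    (auto simp: nth_psums sum_list_sum_nth lessThan_atLeast0 min_absorb2 simp del: upt_Suc intro!: sum.cong)

lemma psi_m1_shuffle: "shuffle_mod_products psi_m1"
  unfolding shuffle_mod_products_def
proof (intro allI impI)
  fix p q :: nat assume pq: "1 \<le> p" "1 \<le> q"
  let ?v = "[1..<p + 1]" and ?w = "[p + 1..<p + q + 1]"
  have dist: "distinct (map X ?v @ map X ?w)"
    by (auto simp: distinct_map inj_on_X)
  have "set (map X ?v) \<union> set (map X ?w) = X ` {1..p + q}"
    unfolding set_map image_Un[symmetric] by (rule arg_cong[where f = "(`) X"]) auto
  then have zsf: "zero_sum_free (set (map X ?v) \<union> set (map X ?w))"
    using zero_sum_free_X[of "{1..p + q}"] by simp
  let ?\<Phi> = "\<lambda>z. rf_app (psi_m1 (length z)) (psums 0 z)"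
  have "(\<Sum>w\<in>Sh p q. rf_app (psi_m1 (p + q)) (map (\<lambda>k. \<Sum>i<k. X (w ! i)) [1..<p + q + 1])) =
      (\<Sum>w\<in>shuffles ?v ?w. ?\<Phi> (map X w))"
    unfolding Sh_eq_shuffles
  proof (rule sum.cong)
    fix w assume "w \<in> shuffles ?v ?w"
    then have "length w = p + q"
      by (simp add: length_shuffles del: upt_Suc)
    then show "rf_app (psi_m1 (p + q)) (map (\<lambda>k. \<Sum>i<k. X (w ! i)) [1..<p + q + 1]) = ?\<Phi> (map X w)"
      using map_partial_sums[of w] by (simp del: upt_Suc)
  qed simp
  also have "\<dots> = qsh 0 ?\<Phi> (map X ?v) (map X ?w)"
    by (rule sum_shuffles_qsh) auto
  also have "\<dots> = qsh 0 (\<lambda>z. psi_val (psums 0 z)) (map X ?v) (map X ?w)"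
  proof (rule qsh_cong[OF dist])
    fix z assume z: "distinct z" "set z \<subseteq> set (map X ?v) \<union> set (map X ?w)"
      "z = [] \<Longrightarrow> map X ?v = [] \<and> map X ?w = []"
    have "distinct (0 # psums 0 z)"
      by (rule distinct_psums[OF z(1) zero_sum_free_mono[OF zsf z(2)]])
    moreover have "psums 0 z \<noteq> []"
      using z(3) pq by (cases z) auto
    ultimately show "?\<Phi> z = psi_val (psums 0 z)"
      using rf_app_psi_m1[of "psums 0 z"] by simp
  qed
  also have "\<dots> = 0"
    by (rule shuffle_psi_val[OF dist zsf]) (use pq in auto)
  finally show "(\<Sum>w\<in>Sh p q. rf_app (psi_m1 (p + q)) (map (\<lambda>k. \<Sum>i<k. X (w ! i)) [1..<p + q + 1])) = 0" .
qed

theorem theorem1p2: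
  shows "psi_m1 \<in> O_ring \<and> homogeneous_of_weight (- 1) psi_m1 \<and> psi_m1 \<in> pdmr"
  using psi_m1_O_ring psi_m1_homogeneous psi_m1_shuffle psi_m1_stuffle by (simp add: pdmr_def)

end
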